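(* Let $T$ be an algebraic torus over an algebraically closed field $k$, with character lattice $\Lambda$, acting linearly on $V=k^n$ by $t(x_1,\ldots,x_n)=(\chi_1(t)x_1,\ldots,\chi_n(t)x_n)$ with $\chi_1,\ldots,\chi_n\in\Lambda$. Let $K$ be the cone in $\Lambda\otimes_{\mathbb{Z}}\mathbb{Q}$ generated by $\chi_1,\ldots,\chi_n$. Then the orbit closure $X=\overline{T(1,\ldots,1)}\subset V$ satisfies the weak separation property (WSP) if and only if the following conditions hold: (1) the cone $K$ is strictly convex; (2) there is no more than one of the characters $\chi_i$ (counted with index $i$) in the interior of any face of $K$ (in particular, $\mathbb{Q}_+\chi_i\neq\mathbb{Q}_+\chi_j$ for $i\neq j$).
   Context: A subset $X$ of a vector space $V$ has the weak separation property (WSP) if for any pair of homogeneous hyperplanes (linear subspaces of codimension one) $H\neq H'$ of $V$ we have $H\cap X\neq H'\cap X$ as sets. Closures are Zariski closures. $\mathbb{Q}_+$ is the set of non-negative rationals; the cone generated by $\chi_1,\dots,\chi_n$ is $\{\sum q_i\chi_i: q_i\in\mathbb{Q}_+\}$. A cone is strictly convex if it contains no line. The faces of $K$ include $K$ itself and, when $K$ is strictly convex, $\{0\}$; the interior of a face means its relative interior (the interior of $\{0\}$ is $\{0\}$). *)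

theory Defs
  imports
    "HOL-Analysis.Analysis"
    "HOL-Computational_Algebra.Computational_Algebra"
    "HOL-Library.Poly_Mapping"
    "HOL-Library.Function_Algebras"
begin

section \<open>Hyperplanes and the weak separation property\<close>

definition hyperplane :: "('k::field ^ 'n) set \<Rightarrow> bool" where
  "hyperplane H \<longleftrightarrow> vec.subspace H \<and> vec.dim H + 1 = CARD('n)"

definition weak_separation :: "('k::field ^ 'n) set \<Rightarrow> bool" where
  "weak_separation X \<longleftrightarrow>
     (\<forall>H H'. hyperplane H \<and> hyperplane H' \<and> H \<noteq> H' \<longrightarrow> H \<inter> X \<noteq> H' \<inter> X)"


section \<open>Zariski topology on affine space\<close>

text \<open>Polynomials in variables indexed by \<open>'n\<close> are finitely supported coefficient
  functions on exponent vectors.\<close>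

definition poly_eval :: "(('n \<Rightarrow>\<^sub>0 nat) \<Rightarrow>\<^sub>0 'k) \<Rightarrow> 'k::comm_ring_1 ^ 'n::finite \<Rightarrow> 'k" where
  "poly_eval p x =
     (\<Sum>m \<in> Poly_Mapping.keys p. Poly_Mapping.lookup p m * (\<Prod>i\<in>UNIV. (x $ i) ^ Poly_Mapping.lookup m i))"

definition zariski_closed :: "('k::comm_ring_1 ^ 'n::finite) set \<Rightarrow> bool" where
  "zariski_closed S \<longleftrightarrow> (\<exists>P. S = {x. \<forall>p\<in>P. poly_eval p x = 0})"


section \<open>Tori, characters and diagonal actions\<close>

text \<open>The torus of rank \<open>r\<close> is \<open>(k\<^sup>*)\<^sup>r\<close>, with coordinates indexed by \<open>j < r\<close>;
  rank \<open>0\<close> is allowed. Its character lattice is \<open>\<int>\<^sup>r\<close>, realised as the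
  integer-valued functions on \<open>nat\<close> vanishing from \<open>r\<close> on; the exponent vector \<open>m\<close> stands for
  the character \<open>t \<mapsto> \<Prod>\<^sub>j t\<^sub>j\<^bsup>m\<^sub>j\<^esup>\<close>.\<close>

definition torus :: "nat \<Rightarrow> (nat \<Rightarrow> 'k::field) set" where
  "torus r = {..<r} \<rightarrow>\<^sub>E (UNIV - {0})"

definition char_lattice :: "nat \<Rightarrow> (nat \<Rightarrow> int) set" where
  "char_lattice r = {m. \<forall>j\<ge>r. m j = 0}"

definition char_eval :: "nat \<Rightarrow> (nat \<Rightarrow> int) \<Rightarrow> (nat \<Rightarrow> 'k::field) \<Rightarrow> 'k" where
  "char_eval r m t = (\<Prod>j<r. t j powi m j)"

definition torus_act ::
    "nat \<Rightarrow> ('n \<Rightarrow> nat \<Rightarrow> int) \<Rightarrow> (nat \<Rightarrow> 'k) \<Rightarrow> 'k ^ 'n \<Rightarrow> 'k::field ^ 'n" where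
  "torus_act r wt t x = (\<chi> i. char_eval r (wt i) t * x $ i)"

definition orbit_closure :: "nat \<Rightarrow> ('n \<Rightarrow> nat \<Rightarrow> int) \<Rightarrow> ('k::field ^ 'n::finite) set" where
  "orbit_closure r wt = zariski_closed hull ((\<lambda>t. torus_act r wt t (\<chi> i. 1)) ` torus r)"


section \<open>Rational cones and their faces\<close>

text \<open>\<open>\<Lambda> \<otimes> \<rat>\<close> is the space of functions \<open>nat \<Rightarrow> rat\<close> vanishing from \<open>r\<close> on, a subspace of the
  \<open>\<rat>\<close>-vector space of all functions \<open>nat \<Rightarrow> rat\<close>.\<close>

definition qscale :: "rat \<Rightarrow> (nat \<Rightarrow> rat) \<Rightarrow> nat \<Rightarrow> rat" where
  "qscale c x = (\<lambda>j. c * x j)"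

interpretation qvec: vector_space qscale
  by standard (auto simp: qscale_def algebra_simps)

definition rat_char :: "(nat \<Rightarrow> int) \<Rightarrow> nat \<Rightarrow> rat" where
  "rat_char m = (\<lambda>j. of_int (m j))"

definition weight_cone :: "('n::finite \<Rightarrow> nat \<Rightarrow> int) \<Rightarrow> (nat \<Rightarrow> rat) set" where
  "weight_cone wt = {\<Sum>i\<in>UNIV. qscale (q i) (rat_char (wt i)) | q. \<forall>i. 0 \<le> q i}"

definition strictly_convex :: "(nat \<Rightarrow> rat) set \<Rightarrow> bool" where
  "strictly_convex K \<longleftrightarrow> \<not> (\<exists>x v. v \<noteq> 0 \<and> (\<forall>c. x + qscale c v \<in> K))"

text \<open>A face is the zero locus in the cone of a linear functional \<open>x \<mapsto> \<Sum>\<^sub>j u\<^sub>j x\<^sub>j\<close> that is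
  non-negative on the cone; \<open>u = 0\<close> gives the cone itself.\<close>

definition cone_face :: "nat \<Rightarrow> (nat \<Rightarrow> rat) set \<Rightarrow> (nat \<Rightarrow> rat) set \<Rightarrow> bool" where
  "cone_face r F K \<longleftrightarrow>
     (\<exists>u. (\<forall>x\<in>K. 0 \<le> (\<Sum>j<r. u j * x j)) \<and> F = {x\<in>K. (\<Sum>j<r. u j * x j) = 0})"

text \<open>Interior of a face relative to its linear span, which is also its affine hull because a face
  contains \<open>0\<close>. The neighbourhoods are those of the maximum norm, all vectors in question
  having finitely many non-zero coordinates.\<close>

definition cone_interior :: "(nat \<Rightarrow> rat) set \<Rightarrow> (nat \<Rightarrow> rat) set" where
  "cone_interior F =
     {x\<in>F. \<exists>e>0. \<forall>y\<in>qvec.span F. (\<forall>j. \<bar>y j - x j\<bar> < e) \<longrightarrow> y \<in> F}"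

end

theory Submission
  imports Defs
begin

text \<open>The points of \<open>X\<close> used are those of the orbits attached to the faces of \<open>K\<close>: for an integral functional \<open>u\<close>,
  non-negative on \<open>K\<close>, and \<open>s \<in> T\<close>, the point with coordinates \<open>\<chi>\<^sub>i(s)\<close> if \<open>u\<close> vanishes on
  \<open>\<chi>\<^sub>i\<close> and \<open>0\<close> otherwise. If two hyperplanes \<open>\<Sum> a\<^sub>i x\<^sub>i = 0\<close> and \<open>\<Sum> b\<^sub>i x\<^sub>i = 0\<close> meet \<open>X\<close> in the same set,
  then for each face the Laurent polynomials \<open>f = \<Sum> a\<^sub>i \<chi>\<^sub>i\<close> and \<open>g = \<Sum> b\<^sub>i \<chi>\<^sub>i\<close>, summed over the face,
  have the same zeros in \<open>T\<close>.

  Consider a minimal face on which \<open>a\<close> and \<open>b\<close> are not proportional. All its characters but at most one,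
  \<open>\<chi>\<^sub>z\<close>, lie on proper faces, where proportionality is known. Equality of zero sets passes to initial
  forms, hence to the faces of the Newton polytope; take a minimal face \<open>M\<close> of it with non-constant
  ratio \<open>a\<^sub>i / b\<^sub>i\<close>. If only \<open>\<chi>\<^sub>z\<close> has a deviating ratio, then \<open>\<chi>\<^sub>z\<close> would vanish at a common
  zero of \<open>f\<close> and \<open>g\<close>. Otherwise \<open>M\<close> is a segment, because in dimension at least two the proper faces of \<open>M\<close>
  are connected to each other; then \<open>f\<close> and \<open>g\<close> are binomials or trinomials, and these are determined
  by their zeros.

  Conversely, a violation of (1) or (2) gives a monomial relation on \<open>X\<close> that forces two coordinate
  hyperplanes to have the same intersection with \<open>X\<close>.\<close>

section \<open>Univariate and bivariate polynomials\<close>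

text \<open>Over a finite field, adding 1 to the product of all \<open>x - a\<close> gives a
  non-constant polynomial without roots.\<close>

lemma infinite_UNIV_alg_closed: "infinite (UNIV :: 'a::alg_closed_field set)"
proof
  assume fin: "finite (UNIV :: 'a set)"
  define p :: "'a poly" where "p = 1 + (\<Prod>a\<in>UNIV. [:-a, 1:])"
  have "degree (\<Prod>a\<in>(UNIV::'a set). [:-a, 1:]) = card (UNIV :: 'a set)"
    by (subst degree_prod_eq_sum_degree) auto
  moreover have "card (UNIV :: 'a set) > 0"
    using fin by (simp add: card_gt_0_iff)
  ultimately have "degree p > 0"
    unfolding p_def by (subst degree_add_eq_right) auto
  then obtain x where "poly p x = 0"
    using alg_closed_imp_poly_has_root by blast
  moreover have "poly (\<Prod>a\<in>(UNIV::'a set). [:-a, 1:]) x = 0"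
    using fin by (auto simp: poly_prod intro!: prod_zero bexI[of _ x])
  ultimately show False by (simp add: p_def)
qed

text \<open>Otherwise the finitely many roots of \<open>p\<close> and \<open>q\<close> would exhaust
  the infinite field. With \<open>q\<close> the variable this extends identities across the point 0;
  with \<open>q = 1\<close> it turns a function that vanishes everywhere into the zero
  polynomial.\<close>

lemma poly_eq_0_if_cofinite_roots:
  fixes p q :: "'a::alg_closed_field poly"
  assumes "q \<noteq> 0" and "\<And>x. poly q x \<noteq> 0 \<Longrightarrow> poly p x = 0"
  shows "p = 0"
proof (rule ccontr)
  assume "p \<noteq> 0"
  hence "finite ({x. poly p x = 0} \<union> {x. poly q x = 0})"
    using assms(1) poly_roots_finite by blast
  moreover have "{x. poly p x = 0} \<union> {x. poly q x = 0} = UNIV"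
    using assms(2) by auto
  ultimately show False using infinite_UNIV_alg_closed by metis
qed

text \<open>Each root of \<open>p\<close> splits off a linear factor that also divides
  \<open>q\<close>; the exponent \<open>d\<close> supplies one copy of \<open>q\<close> per factor,
  whatever the multiplicities.\<close>

lemma dvd_power_if_roots_subset:
  fixes p q :: "'a::alg_closed_field poly"
  assumes "p \<noteq> 0" and "degree p = d" and "\<And>x. poly p x = 0 \<Longrightarrow> poly q x = 0"
  shows "p dvd q ^ d"
  using assms
proof (induction d arbitrary: p)
  case 0
  then show ?case by (metis dvd_trans is_unit_iff_degree one_dvd)
next
  case (Suc d)
  then obtain a where a: "poly p a = 0"
    using alg_closed_imp_poly_has_root[of p] by auto
  then obtain p' where p': "p = [:-a, 1:] * p'"
    by (auto simp: poly_eq_0_iff_dvd)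
  have nz: "p' \<noteq> 0" using p' Suc.prems(1) by auto
  have "degree p = 1 + degree p'"
    unfolding p' using nz by (subst degree_mult_eq) auto
  hence "p' dvd q ^ d"
    using Suc.prems nz p' by (intro Suc.IH) auto
  moreover have "[:-a, 1:] dvd q"
    using a Suc.prems(3) by (simp add: poly_eq_0_iff_dvd[symmetric])
  ultimately show ?case unfolding p' power_Suc by (rule mult_dvd_mono[rotated])
qed

lemma poly_map_poly_eval: "poly (map_poly (\<lambda>c. poly c t) P) x = poly (poly P [:x:]) t"
  by (induction P) (auto simp: map_poly_pCons)

text \<open>For bivariate polynomials the outer variable is \<open>x\<close> and the inner one is \<open>t\<close>. Generically in \<open>t\<close>
  the univariate case shows that \<open>F\<close> divides \<open>(x G)^d\<close>; pseudo-division lifts this to a divisibility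
  up to a polynomial in \<open>t\<close>, from which all factors \<open>t\<close> can be cancelled.\<close>

lemma initial_form_root_bivariate:
  fixes F G :: "'a::alg_closed_field poly poly"
  assumes roots: "\<And>t x. t \<noteq> 0 \<Longrightarrow> x \<noteq> 0 \<Longrightarrow> poly (poly F [:x:]) t = 0 \<Longrightarrow> poly (poly G [:x:]) t = 0"
    and prim: "\<not> [:[:0, 1:]:] dvd F"
    and root: "poly (poly F [:x0:]) 0 = 0" and x0: "x0 \<noteq> 0"
  shows "poly (poly G [:x0:]) 0 = 0"
proof -
  define d where "d = degree F"
  \<comment> \<open>The extra factor \<open>x\<close> takes care of roots \<open>x = 0\<close> of
    \<open>F\<close>, where \<open>roots\<close> gives no information.\<close>
  define P where "P = ([:0, 1:] * G) ^ d"
  have F0: "F \<noteq> 0" using prim by auto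
  define lc where "lc = coeff F d"
  have lc0: "lc \<noteq> 0" using F0 by (simp add: lc_def d_def)
  obtain Q R where QR: "pseudo_divmod P F = (Q, R)" by force
  define e where "e = Suc (degree P) - degree F"
  have eq: "smult (lc ^ e) P = F * Q + R" and R: "R = 0 \<or> degree R < d"
    using pseudo_divmod[OF F0 QR] by (simp_all add: lc_def e_def d_def)
  define ev where "ev t S = map_poly (\<lambda>c. poly c t) S" for t :: 'a and S
  have "R = 0"
  proof (rule poly_eqI)
    fix n
    \<comment> \<open>It suffices to vary \<open>t\<close> off 0 and off the zeros of
      \<open>lc\<close>: there \<open>ev t F\<close> keeps degree \<open>d\<close>, so a specialised
      remainder divisible by it must vanish.\<close>
    have "coeff R n = 0"
    proof (rule poly_eq_0_if_cofinite_roots[where q = "[:0,1:] * lc"])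
      show "[:0,1:] * lc \<noteq> 0" using lc0 by simp
      fix t assume "poly ([:0,1:] * lc) t \<noteq> 0"
      hence t: "t \<noteq> 0" "poly lc t \<noteq> 0" by auto
      have cF: "coeff (ev t F) d \<noteq> 0" using t by (simp add: ev_def coeff_map_poly lc_def)
      hence nz: "ev t F \<noteq> 0" by auto
      have dF: "degree (ev t F) = d"
        using cF le_degree map_poly_degree_leq[of _ F] unfolding ev_def d_def
        by (metis le_antisym)
      have "ev t F dvd ([:0, 1:] * ev t G) ^ d"
      proof (rule dvd_power_if_roots_subset[OF nz dF])
        fix x assume "poly (ev t F) x = 0"
        thus "poly ([:0, 1:] * ev t G) x = 0"
          using roots[OF t(1), of x] by (auto simp: ev_def poly_map_poly_eval)
      qed
      moreover have "smult (poly lc t ^ e) (([:0, 1:] * ev t G) ^ d) = ev t F * ev t Q + ev t R"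
        (is "?l = ?r")
      proof -
        have "poly (?l - ?r) x = 0" for x
        proof -
          have "poly (poly (smult (lc ^ e) P) [:x:]) t = poly (poly (F * Q + R) [:x:]) t"
            by (simp add: eq)
          thus ?thesis by (simp add: ev_def poly_map_poly_eval P_def)
        qed
        hence "?l - ?r = 0"
          by (intro poly_eq_0_if_cofinite_roots[of 1]) auto
        thus ?thesis by simp
      qed
      ultimately have "ev t F dvd ev t R"
        by (metis dvd_add_right_iff dvd_smult dvd_triv_left)
      moreover have "ev t R = 0 \<or> degree (ev t R) < d"
        using R map_poly_degree_leq[of "\<lambda>c. poly c t" R] unfolding ev_def by auto
      ultimately have "ev t R = 0"
        using dF dvd_imp_degree_le by (metis leD)
      hence "coeff (ev t R) n = 0" by simp
      thus "poly (coeff R n) t = 0" by (simp add: ev_def coeff_map_poly)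
    qed
    thus "coeff R n = coeff 0 n" by simp
  qed
  with eq have ex: "\<exists>c Q. c \<noteq> 0 \<and> smult c P = F * Q"
    using lc0 by (metis add.right_neutral power_not_zero)
  \<comment> \<open>A multiplier \<open>c\<close> of least degree cannot vanish at 0:
    \<open>t\<close> is prime and does not divide \<open>F\<close>, so it would divide
    \<open>Q\<close> and could be cancelled from both sides.\<close>
  define N where "N = (LEAST n. \<exists>c Q. c \<noteq> 0 \<and> smult c P = F * Q \<and> degree c = n)"
  have "\<exists>c Q. c \<noteq> 0 \<and> smult c P = F * Q \<and> degree c = N"
    unfolding N_def by (rule LeastI_ex) (use ex in blast)
  then obtain c Q where c: "c \<noteq> 0" "smult c P = F * Q" "degree c = N" by blast
  have least: "N \<le> degree c'" if "c' \<noteq> 0" "smult c' P = F * Q'" for c' Q'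
    unfolding N_def by (rule Least_le) (use that in blast)
  have "poly c 0 \<noteq> 0"
  proof
    assume "poly c 0 = 0"
    then obtain c' where c': "c = [:0, 1:] * c'"
      by (auto simp: poly_eq_0_iff_dvd)
    have "prime_elem [:0, 1::'a:]"
      by (rule prime_elem_linear_field_poly) simp
    hence pr: "prime_elem [:[:0, 1::'a:]:]"
      by (rule lift_prime_elem_poly)
    have "F * Q = [:[:0,1:]:] * smult c' P"
      using c(2) c' by (simp add: mult.commute)
    hence "[:[:0,1:]:] dvd F * Q" by (metis dvd_triv_left)
    with pr prim have "[:[:0,1:]:] dvd Q"
      by (simp add: prime_elem_dvd_mult_iff)
    then obtain Q' where Q': "Q = [:[:0,1:]:] * Q'" by auto
    have "[:[:0,1:]:] * smult c' P = [:[:0,1:]:] * (F * Q')"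
      using \<open>F * Q = [:[:0,1:]:] * smult c' P\<close> Q' by (simp add: mult_ac)
    hence "smult c' P = F * Q'"
      by (subst (asm) mult_cancel_left) auto
    moreover have "c' \<noteq> 0" using c' c(1) by auto
    moreover have "degree c = Suc (degree c')"
      using c' \<open>c' \<noteq> 0\<close> by (simp add: degree_mult_eq)
    ultimately show False using least[of c' Q'] c(3) by simp
  qed
  moreover have "poly (poly (smult c P) [:x0:]) 0 = 0"
    by (simp add: c(2) root)
  ultimately show ?thesis
    using x0 by (simp add: P_def)
qed

text \<open>Once the full power of \<open>x\<close> is split off, the cofactor does not vanish at 0,
  and it is not constant because \<open>p\<close> is not a monomial.\<close>

lemma exists_nonzero_root_if_two_terms:
  fixes p :: "'a::alg_closed_field poly"
  assumes "coeff p m \<noteq> 0" "coeff p n \<noteq> 0" "m \<noteq> n"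
  shows "\<exists>x. x \<noteq> 0 \<and> poly p x = 0"
proof -
  have "p \<noteq> 0" using assms by auto
  then obtain q where q: "p = [:-0, 1:] ^ order 0 p * q" "\<not> [:-0, 1:] dvd q"
    using order_decomp by blast
  hence p: "p = monom 1 (order 0 p) * q"
    by (simp add: monom_altdef)
  have "degree q > 0"
  proof (rule ccontr)
    assume "\<not> degree q > 0"
    then obtain c where "q = [:c:]" using degree_eq_zeroE by blast
    hence "p = monom c (order 0 p)" using p by (simp add: smult_monom mult.commute)
    thus False using assms by (metis coeff_monom)
  qed
  then obtain x where "poly q x = 0" using alg_closed_imp_poly_has_root by blast
  moreover from this have "x \<noteq> 0" using q(2) by (auto simp: poly_eq_0_iff_dvd)
  ultimately show ?thesis using q(1) by (metis poly_mult mult_zero_right)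
qed

lemma power_eq_1_if_coprime:
  fixes w :: "'a::field"
  assumes "coprime p q" "p > 0" "w ^ p = 1" "w ^ q = 1"
  shows "w = 1"
proof -
  obtain x y where "p * x = q * y + 1"
    using bezout_nat[of p q] assms by (auto simp: coprime_iff_gcd_eq_1)
  hence "(w ^ p) ^ x = (w ^ q) ^ y * w"
    by (metis power_add power_mult power_one_right)
  thus ?thesis using assms by simp
qed

lemma monic_eq_if_dvd:
  fixes p q :: "'a::field poly"
  assumes "p dvd q" "degree p = degree q" "lead_coeff p = 1" "lead_coeff q = 1"
  shows "p = q"
proof -
  obtain k where k: "q = p * k" using assms(1) by auto
  have "p \<noteq> 0" "k \<noteq> 0" using assms k by auto
  hence "degree k = 0" using assms(2) k by (simp add: degree_mult_eq)
  then obtain c where c: "k = [:c:]" using degree_eq_zeroE by blast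
  hence "c = 1" using assms(2-4) k c by auto
  thus ?thesis using k c by simp
qed

text \<open>If the two trinomials were not proportional, their common roots would have the same \<open>x\<^sup>p\<close> and the same
  \<open>x\<^sup>q\<close>; in terms of \<open>y = x\<^bsup>gcd p q\<^esup>\<close> there is then only one root \<open>y\<^sub>0\<close>, and both
  trinomials are multiples of the same power of \<open>y - y\<^sub>0\<close>.\<close>

lemma trinomial_roots_determine_end_coeffs:
  fixes u a v u' b v' :: "'a::alg_closed_field"
  assumes q: "0 < q" "q < p" and nz: "u \<noteq> 0" "v \<noteq> 0" "u' \<noteq> 0" "v' \<noteq> 0"
    and roots: "\<And>x. x \<noteq> 0 \<Longrightarrow> u * x ^ p + a * x ^ q + v = 0 \<longleftrightarrow> u' * x ^ p + b * x ^ q + v' = 0"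
  shows "u * v' = u' * v"
proof (rule ccontr)
  assume neq: "u * v' \<noteq> u' * v"
  define a1 v1 b1 v2 where "a1 = a / u" and "v1 = v / u" and "b1 = b / u'" and "v2 = v' / u'"
  have v12: "v1 \<noteq> v2" using neq nz by (auto simp: v1_def v2_def field_simps)
  define d where "d = gcd p q"
  obtain p' q' where pq: "p = d * p'" "q = d * q'" and cop: "coprime p' q'"
    unfolding d_def using gcd_coprime_exists[of p q] q by (metis gcd_eq_0_iff mult.commute not_less_zero)
  have d0: "d > 0" using q by (simp add: d_def)
  have q': "0 < q'" "q' < p'" using q pq d0 by auto
  define F where "F = monom 1 p' + monom a1 q' + [:v1:]"
  define G where "G = monom 1 p' + monom b1 q' + [:v2:]"
  have cf: "coeff F n = (if n = p' then 1 else if n = q' then a1 else if n = 0 then v1 else 0)"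
    "coeff G n = (if n = p' then 1 else if n = q' then b1 else if n = 0 then v2 else 0)" for n
    using q' by (auto simp: F_def G_def coeff_pCons split: nat.splits)
  have deg: "degree F = p'" "degree G = p'"
    by (rule antisym[OF degree_le le_degree]; use q' in \<open>auto simp: cf\<close>)+
  have pF: "poly F y = y ^ p' + a1 * y ^ q' + v1" and pG: "poly G y = y ^ p' + b1 * y ^ q' + v2" for y
    by (simp_all add: F_def G_def poly_monom)
  \<comment> \<open>Every \<open>y\<close> is a \<open>d\<close>-th power, so the hypothesis on
    \<open>x\<close> compares the zeros in \<open>y\<close>; the point \<open>y = 0\<close> is a
    zero of neither, the constant terms being non-zero.\<close>
  have same: "poly F y = 0 \<longleftrightarrow> poly G y = 0" for y
  proof (cases "y = 0")
    case True
    thus ?thesis using q' nz by (simp add: pF pG v1_def v2_def power_0_left)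
  next
    case False
    obtain x where x: "y = x ^ d" using nth_root_exists[OF d0] by metis
    hence x0: "x \<noteq> 0" using False d0 by auto
    have "u * x ^ p + a * x ^ q + v = u * poly F y"
      using nz by (simp add: pF x pq power_mult a1_def v1_def field_simps)
    moreover have "u' * x ^ p + b * x ^ q + v' = u' * poly G y"
      using nz by (simp add: pG x pq power_mult b1_def v2_def field_simps)
    ultimately show ?thesis using roots[OF x0] nz by simp
  qed
  obtain y0 where y0: "poly F y0 = 0"
    using alg_closed_imp_poly_has_root[of F] deg q' by auto
  have uniq: "y = y0" if y: "poly F y = 0" for y
  proof -
    \<comment> \<open>Subtracting the two equations leaves
      \<open>(a1 - b1) * z ^ q' = v2 - v1\<close>; as \<open>v1\<close> and \<open>v2\<close>
      differ, the coefficients determine \<open>z ^ q'\<close> and then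
      \<open>z ^ p'\<close>.\<close>
    have *: "a1 \<noteq> b1 \<and> z \<noteq> 0 \<and> z ^ q' = (v2 - v1) / (a1 - b1) \<and> z ^ p' = - v1 - a1 * ((v2 - v1) / (a1 - b1))"
      if z: "poly F z = 0" for z
    proof -
      have zG: "poly G z = 0" using z same by simp
      have e: "(a1 - b1) * z ^ q' = v2 - v1"
        using z zG unfolding pF pG by (simp add: algebra_simps) (metis add_diff_cancel_left' add_diff_eq diff_add_cancel)
      hence ne: "a1 \<noteq> b1" "z \<noteq> 0" using v12 q' by (auto simp: power_0_left)
      hence zq: "z ^ q' = (v2 - v1) / (a1 - b1)" using e by (simp add: field_simps)
      have "z ^ p' = - v1 - a1 * z ^ q'" using z unfolding pF by (simp add: eq_neg_iff_add_eq_0 algebra_simps)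
      thus ?thesis using ne zq by simp
    qed
    have "y ^ p' = y0 ^ p'" "y ^ q' = y0 ^ q'" and nz0: "y0 \<noteq> 0"
      using *[OF y] *[OF y0] by simp_all
    hence "(y / y0) ^ p' = 1" "(y / y0) ^ q' = 1"
      by (simp_all add: power_divide)
    thus ?thesis using power_eq_1_if_coprime[OF cop] q' by (metis divide_eq_1_iff gr_implies_not0 gr0I)
  qed
  have L: "S = [:- y0, 1:] ^ p'" if "degree S = p'" "lead_coeff S = 1" "\<And>y. poly S y = 0 \<Longrightarrow> y = y0" for S
  proof (rule monic_eq_if_dvd)
    show "S dvd [:- y0, 1:] ^ p'"
      by (rule dvd_power_if_roots_subset) (use that in auto)
    show "lead_coeff ([:- y0, 1:] ^ p') = 1"
      unfolding lead_coeff_power by simp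
  qed (use that in \<open>simp_all add: degree_linear_power\<close>)
  have "F = [:- y0, 1:] ^ p'"
    by (rule L) (simp_all only: deg cf uniq refl if_True)
  moreover have "G = [:- y0, 1:] ^ p'"
    by (rule L) (simp_all only: deg cf uniq refl if_True same[symmetric])
  ultimately have "F = G" by simp
  hence "coeff F 0 = coeff G 0" by simp
  thus False using v12 q' by (simp add: cf)
qed

section \<open>Zeros of Laurent polynomials on the torus\<close>

definition pairing :: "nat \<Rightarrow> (nat \<Rightarrow> int) \<Rightarrow> (nat \<Rightarrow> int) \<Rightarrow> int" where
  "pairing r u m = (\<Sum>j<r. u j * m j)"

text \<open>The translate of the torus point \<open>s\<close> by the value at \<open>x\<close> of the one-parameter subgroup \<open>u\<close>.\<close>
definition twist :: "nat \<Rightarrow> (nat \<Rightarrow> int) \<Rightarrow> 'k::field \<Rightarrow> (nat \<Rightarrow> 'k) \<Rightarrow> nat \<Rightarrow> 'k" where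
  "twist r u x s = (\<lambda>j\<in>{..<r}. x powi u j * s j)"

definition torus_one :: "nat \<Rightarrow> nat \<Rightarrow> 'k::field" where
  "torus_one r = (\<lambda>j\<in>{..<r}. 1)"

definition char_sum ::
    "nat \<Rightarrow> ('n \<Rightarrow> nat \<Rightarrow> int) \<Rightarrow> ('n \<Rightarrow> 'k::field) \<Rightarrow> 'n set \<Rightarrow> (nat \<Rightarrow> 'k) \<Rightarrow> 'k" where
  "char_sum r wt a A s = (\<Sum>i\<in>A. a i * char_eval r (wt i) s)"

lemma torus_one_in_torus: "torus_one r \<in> torus r"
  by (auto simp: torus_one_def torus_def)

lemma char_eval_torus_one: "char_eval r m (torus_one r) = 1"
  by (simp add: char_eval_def torus_one_def)

lemma twist_in_torus:
  assumes "x \<noteq> 0" "s \<in> torus r" shows "twist r u x s \<in> torus r"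
  using assms by (auto simp: twist_def torus_def PiE_iff)

lemma char_eval_nonzero: "s \<in> torus r \<Longrightarrow> char_eval r m s \<noteq> 0"
  by (auto simp: char_eval_def torus_def PiE_iff)

lemma prod_powi:
  fixes x :: "'a::field"
  assumes "x \<noteq> 0" shows "(\<Prod>i\<in>A. x powi f i) = x powi (\<Sum>i\<in>A. f i)"
  by (induction A rule: infinite_finite_induct) (use assms in \<open>simp_all add: power_int_add\<close>)

lemma char_eval_twist:
  assumes "x \<noteq> 0"
  shows "char_eval r m (twist r u x s) = x powi pairing r u m * char_eval r m s"
proof -
  have "char_eval r m (twist r u x s) = (\<Prod>j<r. x powi (u j * m j)) * char_eval r m s"
    by (simp add: char_eval_def twist_def power_int_mult_distrib power_int_mult prod.distrib)
  thus ?thesis using assms by (simp add: prod_powi pairing_def)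
qed

lemma char_sum_mono_neutral:
  assumes "finite A" "B \<subseteq> A" "\<And>i. i \<in> A - B \<Longrightarrow> a i = 0"
  shows "char_sum r wt a A s = char_sum r wt a B s"
  unfolding char_sum_def by (rule sum.mono_neutral_right) (use assms in auto)

text \<open>The cocharacter \<open>(1, x, x^2, ...)\<close> works: for distinct characters the
  difference of the pairings is a non-zero polynomial in \<open>x\<close>, and some integer
  \<open>x\<close> avoids the roots of all of these.\<close>

lemma exists_separating_cocharacter:
  assumes fin: "finite A" and inj: "inj_on wt A" and lat: "\<And>i. i \<in> A \<Longrightarrow> wt i \<in> char_lattice r"
  shows "\<exists>u. inj_on (\<lambda>i. pairing r u (wt i)) A"
proof -
  define p where "p = (\<lambda>(i, k). \<Sum>j<r. monom (wt i j - wt k j) j)"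
  define D where "D = {ik \<in> A \<times> A. fst ik \<noteq> snd ik}"
  have finD: "finite D" using fin by (simp add: D_def)
  have coeff_p: "coeff (p (i, k)) j = (if j < r then wt i j - wt k j else 0)" for i k j
    by (simp add: p_def coeff_sum)
  have "p ik \<noteq> 0" if "ik \<in> D" for ik
  proof -
    obtain i k where "ik = (i, k)" by force
    with that have ik: "ik = (i, k)" "i \<in> A" "k \<in> A" "i \<noteq> k" by (auto simp: D_def)
    hence "wt i \<noteq> wt k" using inj by (auto dest: inj_onD)
    then obtain j where j: "wt i j \<noteq> wt k j" by blast
    hence "j < r" using lat ik by (auto simp: char_lattice_def not_le[symmetric])
    hence "coeff (p ik) j \<noteq> 0" using j ik by (simp add: coeff_p)
    thus ?thesis by auto
  qed
  hence "(\<Prod>ik\<in>D. p ik) \<noteq> 0" using finD by simp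
  hence "finite {x. poly (\<Prod>ik\<in>D. p ik) x = 0}" by (rule poly_roots_finite)
  then obtain x where x: "poly (\<Prod>ik\<in>D. p ik) x \<noteq> 0"
    using infinite_UNIV_int by (metis (mono_tags, lifting) UNIV_eq_I mem_Collect_eq)
  have "inj_on (\<lambda>i. pairing r (\<lambda>j. x ^ j) (wt i)) A"
  proof (rule inj_onI, rule ccontr)
    fix i k assume ik: "i \<in> A" "k \<in> A" "i \<noteq> k"
      and eq: "pairing r (\<lambda>j. x ^ j) (wt i) = pairing r (\<lambda>j. x ^ j) (wt k)"
    have "poly (p (i, k)) x = 0"
      using eq by (simp add: p_def pairing_def poly_sum poly_monom algebra_simps sum_subtractf)
    moreover have "(i, k) \<in> D" using ik by (simp add: D_def)
    ultimately show False using x finD by (simp add: poly_prod)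
  qed
  thus ?thesis by blast
qed

lemma powi_nat_diff:
  assumes "(x::'a::field) \<noteq> 0" "(m::int) \<le> e"
  shows "x powi e = x powi m * x ^ nat (e - m)"
proof -
  have "x powi e = x powi (m + (e - m))" by simp
  also have "\<dots> = x powi m * x powi (e - m)" using assms(1) by (subst power_int_add) auto
  also have "x powi (e - m) = x ^ nat (e - m)" using assms(2) by (simp add: power_int_def)
  finally show ?thesis .
qed

lemma coeff_sum_monom_inj:
  assumes "finite A" "inj_on e A" "i \<in> A"
  shows "coeff (\<Sum>k\<in>A. monom (c k) (e k)) (e i) = c i"
proof -
  have "coeff (\<Sum>k\<in>A. monom (c k) (e k)) (e i) = (\<Sum>k\<in>A. if k = i then c k else 0)"
    unfolding coeff_sum by (rule sum.cong) (use assms in \<open>auto dest: inj_onD\<close>)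
  thus ?thesis using assms by simp
qed

lemma finite_lower_bound_int:
  assumes "finite A" shows "\<exists>m::int. \<forall>i\<in>A. m \<le> f i"
  by (intro exI[of _ "Min (insert 0 (f ` A))"]) (use assms in auto)

lemma inj_on_nat_diff:
  assumes "inj_on f A" "\<And>i. i \<in> A \<Longrightarrow> (m::int) \<le> f i"
  shows "inj_on (\<lambda>i. nat (f i - m)) A"
  by (rule inj_onI) (use assms in \<open>auto dest!: inj_onD simp: nat_eq_iff2\<close>)

text \<open>A separating cocharacter sends distinct characters to distinct powers of
  \<open>x\<close>, so no terms merge and the coefficients \<open>a i\<close> survive in
  \<open>P\<close>; the factor \<open>x powi m\<close> absorbs negative exponents.\<close>

lemma char_sum_on_generic_line:
  fixes a :: "'n \<Rightarrow> 'k::field"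
  assumes fin: "finite A" and inj: "inj_on wt A" and lat: "\<And>i. i \<in> A \<Longrightarrow> wt i \<in> char_lattice r"
  shows "\<exists>P e m u. inj_on e A \<and> (\<forall>i\<in>A. coeff P (e i) = a i) \<and>
    (\<forall>x. x \<noteq> 0 \<longrightarrow> char_sum r wt a A (twist r u x (torus_one r)) = x powi m * poly P x)"
proof -
  obtain u where u: "inj_on (\<lambda>i. pairing r u (wt i)) A"
    using exists_separating_cocharacter[OF assms] by blast
  obtain m where m: "\<And>i. i \<in> A \<Longrightarrow> m \<le> pairing r u (wt i)"
    using finite_lower_bound_int[OF fin, of "\<lambda>i. pairing r u (wt i)"] by blast
  define e where "e i = nat (pairing r u (wt i) - m)" for i
  define P where "P = (\<Sum>i\<in>A. monom (a i) (e i))"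
  have e: "inj_on e A" unfolding e_def by (rule inj_on_nat_diff[OF u m])
  have "coeff P (e i) = a i" if "i \<in> A" for i
    unfolding P_def by (rule coeff_sum_monom_inj[OF fin e that])
  moreover have "char_sum r wt a A (twist r u x (torus_one r)) = x powi m * poly P x"
    if x: "x \<noteq> 0" for x
  proof -
    have "char_sum r wt a A (twist r u x (torus_one r)) = (\<Sum>i\<in>A. a i * x powi pairing r u (wt i))"
      by (simp add: char_sum_def char_eval_twist[OF x] char_eval_torus_one)
    also have "\<dots> = (\<Sum>i\<in>A. x powi m * (a i * x ^ e i))"
      by (rule sum.cong) (simp_all add: powi_nat_diff[OF x m] e_def)
    finally show ?thesis by (simp add: P_def poly_sum poly_monom sum_distrib_left)
  qed
  ultimately show ?thesis using e by blast
qed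

lemma char_sum_not_identically_0:
  fixes a :: "'n \<Rightarrow> 'k::alg_closed_field"
  assumes "finite A" "inj_on wt A" "\<And>i. i \<in> A \<Longrightarrow> wt i \<in> char_lattice r"
    and i: "i \<in> A" "a i \<noteq> 0"
  shows "\<exists>s\<in>torus r. char_sum r wt a A s \<noteq> 0"
proof -
  obtain P e m u where P: "\<forall>i\<in>A. coeff P (e i) = a i"
    "\<forall>x. x \<noteq> 0 \<longrightarrow> char_sum r wt a A (twist r u x (torus_one r)) = x powi m * poly P x"
    using char_sum_on_generic_line[OF assms(1-3)] by metis
  have "P \<noteq> 0" using P(1) i by force
  then obtain x where "x \<noteq> 0" "poly P x \<noteq> 0"
    using poly_eq_0_if_cofinite_roots[of "[:0, 1:]" P] by auto
  thus ?thesis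
    using P(2) by (intro bexI[of _ "twist r u x (torus_one r)"] twist_in_torus torus_one_in_torus) auto
qed

lemma char_sum_has_zero:
  fixes a :: "'n \<Rightarrow> 'k::alg_closed_field"
  assumes "finite A" "inj_on wt A" "\<And>i. i \<in> A \<Longrightarrow> wt i \<in> char_lattice r"
    and i: "i \<in> A" "a i \<noteq> 0" and k: "k \<in> A" "a k \<noteq> 0" and "i \<noteq> k"
  shows "\<exists>s\<in>torus r. char_sum r wt a A s = 0"
proof -
  obtain P e m u where e: "inj_on e A" and P: "\<forall>i\<in>A. coeff P (e i) = a i"
    "\<forall>x. x \<noteq> 0 \<longrightarrow> char_sum r wt a A (twist r u x (torus_one r)) = x powi m * poly P x"
    using char_sum_on_generic_line[OF assms(1-3)] by metis
  have "e i \<noteq> e k" using e i k \<open>i \<noteq> k\<close> by (auto dest: inj_onD)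
  then obtain x where "x \<noteq> 0" "poly P x = 0"
    using exists_nonzero_root_if_two_terms[of P "e i" "e k"] P(1) i k by auto
  thus ?thesis
    using P(2) by (intro bexI[of _ "twist r u x (torus_one r)"] twist_in_torus torus_one_in_torus) auto
qed

text \<open>Move \<open>s\<close> by \<open>l\<close> with parameter \<open>t\<close> and by a
  separating cocharacter with parameter \<open>x\<close>. Up to monomial factors this gives
  polynomials in \<open>t\<close> and \<open>x\<close> for the bivariate lemma: \<open>t = 0\<close>
  leaves the terms of lowest \<open>l\<close>-weight, and \<open>x = 1\<close> returns to
  \<open>s\<close>.\<close>

lemma initial_form_zeros_subset:
  fixes a b :: "'n \<Rightarrow> 'k::alg_closed_field"
  assumes fin: "finite A" and inj: "inj_on wt A" and lat: "\<And>i. i \<in> A \<Longrightarrow> wt i \<in> char_lattice r"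
    and zeros: "\<And>s. s \<in> torus r \<Longrightarrow> char_sum r wt a A s = 0 \<Longrightarrow> char_sum r wt b A s = 0"
    and min: "\<And>i. i \<in> A \<Longrightarrow> m \<le> pairing r l (wt i)"
    and M: "M = {i \<in> A. pairing r l (wt i) = m}" and i0: "i0 \<in> M" "a i0 \<noteq> 0"
    and s: "s \<in> torus r" "char_sum r wt a M s = 0"
  shows "char_sum r wt b M s = 0"
proof -
  obtain u where u: "inj_on (\<lambda>i. pairing r u (wt i)) A"
    using exists_separating_cocharacter[OF fin inj lat] by blast
  obtain m' where m': "\<And>i. i \<in> A \<Longrightarrow> m' \<le> pairing r u (wt i)"
    using finite_lower_bound_int[OF fin, of "\<lambda>i. pairing r u (wt i)"] by blast
  define e where "e i = nat (pairing r u (wt i) - m')" for i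
  define h where "h i = nat (pairing r l (wt i) - m)" for i
  have e: "inj_on e A" unfolding e_def by (rule inj_on_nat_diff[OF u m'])
  define B where "B c = (\<Sum>i\<in>A. monom (monom (c i * char_eval r (wt i) s) (h i)) (e i))"
    for c :: "'n \<Rightarrow> 'k"
  have eval: "poly (poly (B c) [:x:]) t = (\<Sum>i\<in>A. c i * char_eval r (wt i) s * t ^ h i * x ^ e i)"
    for c x t
    by (simp add: B_def poly_sum poly_monom)
  have generic: "char_sum r wt c A (twist r l t (twist r u x s)) =
      t powi m * x powi m' * poly (poly (B c) [:x:]) t" if "t \<noteq> 0" "x \<noteq> 0" for c t x
    unfolding eval char_sum_def sum_distrib_left
    by (rule sum.cong)
      (simp_all add: char_eval_twist that h_def e_def powi_nat_diff[OF that(1) min] powi_nat_diff[OF that(2) m'])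
  have special: "poly (poly (B c) [:1:]) 0 = char_sum r wt c M s" for c
  proof -
    have "poly (poly (B c) [:1:]) 0 = (\<Sum>i\<in>A. if pairing r l (wt i) = m then c i * char_eval r (wt i) s else 0)"
      unfolding eval by (rule sum.cong) (use min in \<open>force simp: h_def power_0_left\<close>)+
    also have "\<dots> = char_sum r wt c M s"
      unfolding char_sum_def M using fin by (simp add: sum.inter_filter)
    finally show ?thesis .
  qed
  have "poly (poly (B b) [:1:]) 0 = 0"
  proof (rule initial_form_root_bivariate)
    fix t x :: 'k assume "t \<noteq> 0" "x \<noteq> 0" "poly (poly (B a) [:x:]) t = 0"
    thus "poly (poly (B b) [:x:]) t = 0"
      using zeros[of "twist r l t (twist r u x s)"] s(1) by (auto simp: generic twist_in_torus)
  next
    \<comment> \<open>As \<open>e\<close> separates the indices, this coefficient is the single term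
      of \<open>i0\<close>, which is constant in \<open>t\<close>; hence \<open>t\<close> does not
      divide \<open>B a\<close>.\<close>
    have "coeff (B a) (e i0) = monom (a i0 * char_eval r (wt i0) s) (h i0)"
      unfolding B_def by (rule coeff_sum_monom_inj[OF fin e]) (use i0 M in auto)
    moreover have "h i0 = 0" using i0 M by (simp add: h_def)
    ultimately have "\<not> [:0, 1:] dvd coeff (B a) (e i0)"
      using i0(2) char_eval_nonzero[OF s(1)] by (simp add: poly_eq_0_iff_dvd[of _ 0, simplified, symmetric] poly_monom)
    thus "\<not> [:[:0, 1:]:] dvd B a" by (simp add: const_poly_dvd_iff) blast
  qed (use s in \<open>simp_all add: special\<close>)
  thus ?thesis by (simp add: special)
qed

section \<open>Faces of Newton polytopes as sets of minimisers\<close>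

definition argmin_on :: "'n set \<Rightarrow> ('n \<Rightarrow> int) \<Rightarrow> 'n set" where
  "argmin_on M f = {i \<in> M. \<forall>k\<in>M. f i \<le> f k}"

lemma argmin_on_nonempty:
  assumes "finite M" "M \<noteq> {}" shows "argmin_on M f \<noteq> {}"
proof -
  obtain i where "i \<in> M" "f i = Min (f ` M)"
    using assms by (metis (no_types, lifting) Min_in finite_imageI image_iff image_is_empty)
  hence "i \<in> argmin_on M f" using assms by (simp add: argmin_on_def)
  thus ?thesis by blast
qed

text \<open>Moving from \<open>f\<close> to \<open>g\<close> through combinations \<open>\<alpha> f + \<beta> g\<close>, the minimisers change class only
  across a tie. The number of pairs ordered oppositely by \<open>f\<close> and \<open>g\<close> drops when the combination
  is chosen to equate such a pair.\<close>

lemma argmin_class_connected: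
  fixes M :: "'n set" and c :: "'n \<Rightarrow> 'c" and L :: "('n \<Rightarrow> int) set"
  assumes fin: "finite M" and ne: "M \<noteq> {}"
    and closed: "\<And>f g \<alpha> \<beta>. f \<in> L \<Longrightarrow> g \<in> L \<Longrightarrow> (\<lambda>k. \<alpha> * f k + \<beta> * g k) \<in> L"
    and hom: "\<And>f i j. f \<in> L \<Longrightarrow> \<not> f constant_on M \<Longrightarrow> i \<in> argmin_on M f \<Longrightarrow> j \<in> argmin_on M f \<Longrightarrow> c i = c j"
    and "f \<in> L" "g \<in> L"
    and "\<And>\<alpha> \<beta>. 0 \<le> \<alpha> \<Longrightarrow> 0 \<le> \<beta> \<Longrightarrow> (\<alpha>, \<beta>) \<noteq> (0, 0) \<Longrightarrow> \<not> (\<lambda>k. \<alpha> * f k + \<beta> * g k) constant_on M"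
    and "i \<in> argmin_on M f" "j \<in> argmin_on M g"
  shows "c i = c j"
  using assms(5-9)
proof (induction "card {(k, l) \<in> M \<times> M. f k < f l \<and> g l < g k}" arbitrary: f g i j rule: less_induct)
  case less
  let ?inv = "\<lambda>f g. {(k, l) \<in> M \<times> M. f k < f l \<and> g l < (g k :: int)}"
  have fin_inv: "finite (?inv f g)" for f g :: "'n \<Rightarrow> int"
    using fin by (rule_tac finite_subset[of _ "M \<times> M"]) auto
  have nc_f: "\<not> f constant_on M" and nc_g: "\<not> g constant_on M"
    using less.prems(3)[of 1 0] less.prems(3)[of 0 1] by simp_all
  show ?case
  proof (cases "?inv f g = {}")
    \<comment> \<open>With no opposed pair, a minimiser of \<open>g\<close> among the minimisers of
      \<open>f\<close> minimises \<open>g\<close> on all of \<open>M\<close>, so the two minimiser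
      sets share \<open>p\<close>.\<close>
    case True
    have "argmin_on M f \<noteq> {}" "finite (argmin_on M f)"
      using argmin_on_nonempty[OF fin ne] fin by (auto simp: argmin_on_def)
    then obtain p where p: "p \<in> argmin_on (argmin_on M f) g"
      using argmin_on_nonempty by blast
    hence pf: "p \<in> argmin_on M f" by (simp add: argmin_on_def)
    have "g p \<le> g k" if "k \<in> M" for k
    proof (cases "k \<in> argmin_on M f")
      case True
      thus ?thesis using p by (auto simp: argmin_on_def)
    next
      case False
      hence "f p < f k" using pf that by (force simp: argmin_on_def)
      thus ?thesis using True that pf by (force simp: argmin_on_def)
    qed
    hence pg: "p \<in> argmin_on M g" using pf by (simp add: argmin_on_def)
    have "c i = c p" by (rule hom[OF less.prems(1) nc_f less.prems(4) pf])
    also have "c p = c j" by (rule hom[OF less.prems(2) nc_g pg less.prems(5)])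
    finally show ?thesis .
  next
    case False
    then obtain k l where kl: "k \<in> M" "l \<in> M" "f k < f l" "g l < g k" by blast
    define \<alpha> \<beta> where "\<alpha> = g k - g l" and "\<beta> = f l - f k"
    have pos: "\<alpha> > 0" "\<beta> > 0" using kl by (simp_all add: \<alpha>_def \<beta>_def)
    define h where "h = (\<lambda>k. \<alpha> * f k + \<beta> * g k)"
    have hL: "h \<in> L" unfolding h_def by (rule closed[OF less.prems(1,2)])
    have tie: "h k = h l" by (simp add: h_def \<alpha>_def \<beta>_def algebra_simps)
    obtain q where q: "q \<in> argmin_on M h" using argmin_on_nonempty[OF fin ne] by blast
    have inv1: "?inv f h \<subseteq> ?inv f g"
    proof clarsimp
      fix x y assume "f x < f y" "h y < h x"
      hence "\<alpha> * f x < \<alpha> * f y" "\<alpha> * f y + \<beta> * g y < \<alpha> * f x + \<beta> * g x"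
        using pos by (simp_all add: h_def)
      hence "\<beta> * g y < \<beta> * g x" by linarith
      thus "g y < g x" using pos by simp
    qed
    have inv2: "?inv h g \<subseteq> ?inv f g"
    proof clarsimp
      fix x y assume "h x < h y" "g y < g x"
      hence "\<beta> * g y < \<beta> * g x" "\<alpha> * f x + \<beta> * g x < \<alpha> * f y + \<beta> * g y"
        using pos by (simp_all add: h_def)
      hence "\<alpha> * f x < \<alpha> * f y" by linarith
      thus "f x < f y" using pos by simp
    qed
    have klinv: "(k, l) \<in> ?inv f g" "(k, l) \<notin> ?inv f h" "(k, l) \<notin> ?inv h g"
      using kl tie by auto
    have "c i = c q"
    proof (rule less.hyps[OF _ less.prems(1) hL _ less.prems(4) q])
      show "card (?inv f h) < card (?inv f g)"
        using inv1 klinv by (intro psubset_card_mono fin_inv) blast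
      \<comment> \<open>Non-trivial non-negative combinations of \<open>f\<close> and
        \<open>h\<close> are again such combinations of \<open>f\<close> and \<open>g\<close>, so
        the hypothesis that none is constant is inherited.\<close>
      fix x y :: int assume "0 \<le> x" "0 \<le> y" "(x, y) \<noteq> (0, 0)"
      hence "0 \<le> x + y * \<alpha>" "0 \<le> y * \<beta>" "(x + y * \<alpha>, y * \<beta>) \<noteq> (0, 0)"
        using pos by auto
      from less.prems(3)[OF this] show "\<not> (\<lambda>k. x * f k + y * h k) constant_on M"
        by (simp add: h_def algebra_simps)
    qed
    also have "c q = c j"
    proof (rule less.hyps[OF _ hL less.prems(2) _ q less.prems(5)])
      show "card (?inv h g) < card (?inv f g)"
        using inv2 klinv by (intro psubset_card_mono fin_inv) blast
      fix x y :: int assume "0 \<le> x" "0 \<le> y" "(x, y) \<noteq> (0, 0)"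
      hence "0 \<le> x * \<alpha>" "0 \<le> y + x * \<beta>" "(x * \<alpha>, y + x * \<beta>) \<noteq> (0, 0)"
        using pos by auto
      from less.prems(3)[OF this] show "\<not> (\<lambda>k. x * h k + y * g k) constant_on M"
        by (simp add: h_def algebra_simps)
    qed
    finally show ?thesis .
  qed
qed

lemma pairing_lincomb:
  "pairing r (\<lambda>j. \<alpha> * u j + \<beta> * v j) m = \<alpha> * pairing r u m + \<beta> * pairing r v m"
  by (simp add: pairing_def sum.distrib sum_distrib_left algebra_simps)

section \<open>Laurent polynomials with equal zero sets\<close>

definition same_zeros ::
    "nat \<Rightarrow> ('n \<Rightarrow> nat \<Rightarrow> int) \<Rightarrow> ('n \<Rightarrow> 'k::field) \<Rightarrow> ('n \<Rightarrow> 'k) \<Rightarrow> 'n set \<Rightarrow> bool" where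
  "same_zeros r wt a b M \<longleftrightarrow>
     (\<forall>s\<in>torus r. char_sum r wt a M s = 0 \<longleftrightarrow> char_sum r wt b M s = 0)"

lemma same_zeros_sym: "same_zeros r wt a b M \<Longrightarrow> same_zeros r wt b a M"
  by (simp add: same_zeros_def)

text \<open>The initial-form lemma is used in both directions; \<open>i0\<close> guarantees that the
  restriction to the face is the initial form of both Laurent polynomials.\<close>

lemma same_zeros_argmin:
  fixes a b :: "'n \<Rightarrow> 'k::alg_closed_field"
  assumes "finite M" "inj_on wt M" "\<And>i. i \<in> M \<Longrightarrow> wt i \<in> char_lattice r"
    and eq: "same_zeros r wt a b M"
    and i0: "i0 \<in> argmin_on M (\<lambda>i. pairing r u (wt i))" "a i0 \<noteq> 0" "b i0 \<noteq> 0"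
  shows "same_zeros r wt a b (argmin_on M (\<lambda>i. pairing r u (wt i)))"
proof -
  define M' where "M' = argmin_on M (\<lambda>i. pairing r u (wt i))"
  define m where "m = pairing r u (wt i0)"
  have min: "m \<le> pairing r u (wt i)" if "i \<in> M" for i
    using i0(1) that by (simp add: m_def argmin_on_def)
  have M': "M' = {i \<in> M. pairing r u (wt i) = m}"
    using i0(1) by (auto simp: M'_def m_def argmin_on_def intro: antisym)
  have i0': "i0 \<in> M'" using i0(1) by (simp add: M'_def)
  have "char_sum r wt d M' s = 0"
    if "same_zeros r wt c d M" "c i0 \<noteq> 0" "s \<in> torus r" "char_sum r wt c M' s = 0"
    for c d :: "'n \<Rightarrow> 'k" and s
    by (rule initial_form_zeros_subset[OF assms(1-3) _ min M' i0' that(2-4)])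
      (use that(1) in \<open>auto simp: same_zeros_def\<close>)
  from this[OF eq i0(2)] this[OF same_zeros_sym[OF eq] i0(3)]
  show ?thesis unfolding same_zeros_def M'_def by blast
qed

text \<open>A common zero exists, and there the two non-zero character values solve a homogeneous
  linear system, so its determinant vanishes.\<close>

lemma same_zeros_proportional_binomial:
  fixes a b :: "'n \<Rightarrow> 'k::alg_closed_field"
  assumes "wt i \<noteq> wt j" "wt i \<in> char_lattice r" "wt j \<in> char_lattice r"
    and nz: "a i \<noteq> 0" "a j \<noteq> 0" and eq: "same_zeros r wt a b {i, j}"
  shows "a i * b j = a j * b i"
proof -
  have ij: "i \<noteq> j" using assms(1) by auto
  obtain s where s: "s \<in> torus r" "char_sum r wt a {i, j} s = 0"
    using char_sum_has_zero[of "{i, j}" wt r i a j] assms ij by (auto simp: inj_on_def)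
  hence "char_sum r wt b {i, j} s = 0" using eq by (simp add: same_zeros_def)
  with s ij have *: "a i * char_eval r (wt i) s + a j * char_eval r (wt j) s = 0"
    "b i * char_eval r (wt i) s + b j * char_eval r (wt j) s = 0"
    by (simp_all add: char_sum_def)
  have "(a i * b j - a j * b i) * char_eval r (wt i) s =
      b j * (a i * char_eval r (wt i) s + a j * char_eval r (wt j) s) -
      a j * (b i * char_eval r (wt i) s + b j * char_eval r (wt j) s)"
    by (simp add: algebra_simps)
  hence "(a i * b j - a j * b i) * char_eval r (wt i) s = 0" by (simp only: *) simp
  thus ?thesis using char_eval_nonzero[OF s(1)] by simp
qed

text \<open>Along the one-parameter subgroup \<open>w\<close> the characters become
  \<open>1\<close>, \<open>x ^ q\<close>, \<open>x ^ p\<close> up to a common power, which reduces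
  the claim to trinomials in one variable. The middle coefficients may vanish.\<close>

lemma same_zeros_proportional_trinomial:
  fixes a b :: "'n \<Rightarrow> 'k::alg_closed_field"
  assumes order: "pairing r w (wt i) < pairing r w (wt z)" "pairing r w (wt z) < pairing r w (wt j)"
    and nz: "a i \<noteq> 0" "a j \<noteq> 0" "b i \<noteq> 0" "b j \<noteq> 0" and eq: "same_zeros r wt a b {i, z, j}"
  shows "a i * b j = a j * b i"
proof -
  define m where "m = pairing r w (wt i)"
  define p q where "p = nat (pairing r w (wt j) - m)" and "q = nat (pairing r w (wt z) - m)"
  have pq: "0 < q" "q < p" using order by (auto simp: p_def q_def m_def)
  have dist: "i \<noteq> z" "i \<noteq> j" "z \<noteq> j" using order by auto
  have eval: "char_sum r wt c {i, z, j} (twist r w x (torus_one r)) =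
      x powi m * (c j * x ^ p + c z * x ^ q + c i)" if x: "x \<noteq> 0" for x and c :: "'n \<Rightarrow> 'k"
    using dist order powi_nat_diff[OF x, of m "pairing r w (wt j)"] powi_nat_diff[OF x, of m "pairing r w (wt z)"]
    by (simp add: char_sum_def char_eval_twist[OF x] char_eval_torus_one p_def q_def m_def algebra_simps)
  have "a j * b i = b j * a i"
  proof (rule trinomial_roots_determine_end_coeffs[OF pq])
    fix x :: 'k assume x: "x \<noteq> 0"
    show "a j * x ^ p + a z * x ^ q + a i = 0 \<longleftrightarrow> b j * x ^ p + b z * x ^ q + b i = 0"
      using eq twist_in_torus[OF x torus_one_in_torus, of r w] x
      by (force simp: same_zeros_def eval)
  qed (use nz in auto)
  thus ?thesis by (simp add: mult.commute)
qed

text \<open>At the exceptional index \<open>z\<close> one of the two coefficients may be \<open>0\<close>; the ratio is then \<open>0\<close>, also when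
  \<open>b z = 0\<close>, and differs from all other ratios as it should.\<close>

lemma coeff_ratio_constant:
  fixes a b :: "'n \<Rightarrow> 'k::alg_closed_field"
  assumes "finite M" and "inj_on wt M" and "\<And>i. i \<in> M \<Longrightarrow> wt i \<in> char_lattice r"
    and "\<And>i. i \<in> M \<Longrightarrow> i \<noteq> z \<Longrightarrow> a i \<noteq> 0 \<and> b i \<noteq> 0"
    and "\<And>i. i \<in> M \<Longrightarrow> a i \<noteq> 0 \<or> b i \<noteq> 0"
    and "same_zeros r wt a b M"
    and "\<And>i. i \<in> M \<Longrightarrow> i \<noteq> z \<Longrightarrow> \<exists>w. (\<forall>k\<in>M. 0 \<le> pairing r w (wt k)) \<and> pairing r w (wt i) = 0 \<and>
      (\<forall>k\<in>M. \<forall>l\<in>M. pairing r w (wt k) = 0 \<longrightarrow> pairing r w (wt l) = 0 \<longrightarrow> a k / b k = a l / b l)"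
    and "i \<in> M" "j \<in> M"
  shows "a i / b i = a j / b j"
  using assms
proof (induction "card M" arbitrary: M i j rule: less_induct)
  case less
  note fin = less.prems(1) and inj = less.prems(2) and lat = less.prems(3) and nz = less.prems(4)
    and nz' = less.prems(5) and eq = less.prems(6) and bd = less.prems(7)
  define c where "c k = a k / b k" for k
  define ev where "ev w k = pairing r w (wt k)" for w k
  have closed: "(\<lambda>k. \<alpha> * f k + \<beta> * g k) \<in> range ev" if fg: "f \<in> range ev" "g \<in> range ev" for f g \<alpha> \<beta>
  proof -
    obtain u where "f = ev u" using fg(1) by (rule rangeE)
    moreover obtain v where "g = ev v" using fg(2) by (rule rangeE)
    ultimately have "(\<lambda>k. \<alpha> * f k + \<beta> * g k) = ev (\<lambda>j. \<alpha> * u j + \<beta> * v j)"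
      by (auto simp: ev_def pairing_lincomb)
    thus ?thesis by blast
  qed
  \<comment> \<open>The induction hypothesis covers a proper face as soon as it contains an index
    other than \<open>z\<close>, where both coefficients are non-zero; the face \<open>{z}\<close>
    has a single ratio anyway.\<close>
  have hom: "c i = c j" if f: "f \<in> range ev" and nc: "\<not> f constant_on M"
    and i: "i \<in> argmin_on M f" and j: "j \<in> argmin_on M f" for f i j
  proof (cases "argmin_on M f \<subseteq> {z}")
    case True
    thus ?thesis using i j by blast
  next
    case False
    define M' where "M' = argmin_on M f"
    obtain u where "f = ev u" using f by auto
    hence u: "f = (\<lambda>i. pairing r u (wt i))" by (auto simp: ev_def)
    have sub: "M' \<subseteq> M" by (auto simp: M'_def argmin_on_def)
    have "M' \<noteq> M"
    proof
      assume "M' = M"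
      hence "f k = f i" if "k \<in> M" for k
        using that i unfolding M'_def argmin_on_def by (blast intro: antisym)
      thus False using nc by (auto simp: constant_on_def)
    qed
    with sub have "M' \<subset> M" by blast
    obtain i0 where i0: "i0 \<in> M'" "i0 \<noteq> z" using False M'_def by blast
    have "a i / b i = a j / b j"
    proof (rule less.hyps[where M = M'])
      show "card M' < card M" using \<open>M' \<subset> M\<close> fin by (rule psubset_card_mono[rotated])
      show "same_zeros r wt a b M'"
        unfolding M'_def u
      proof (rule same_zeros_argmin[OF fin inj lat eq])
        show "i0 \<in> argmin_on M (\<lambda>i. pairing r u (wt i))"
          using i0(1) by (simp add: M'_def u)
        show "a i0 \<noteq> 0" "b i0 \<noteq> 0" using nz[of i0] i0 sub by auto
      qed
      show "inj_on wt M'" using inj sub by (rule inj_on_subset)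
      show "finite M'" using sub fin by (rule finite_subset)
      fix k assume k: "k \<in> M'"
      show "wt k \<in> char_lattice r" using lat k sub by blast
      show "a k \<noteq> 0 \<or> b k \<noteq> 0" using nz' k sub by blast
      assume kz: "k \<noteq> z"
      show "a k \<noteq> 0 \<and> b k \<noteq> 0" using nz k kz sub by blast
      obtain w where w: "\<forall>k\<in>M. 0 \<le> pairing r w (wt k)" "pairing r w (wt k) = 0"
        "\<forall>k\<in>M. \<forall>l\<in>M. pairing r w (wt k) = 0 \<longrightarrow> pairing r w (wt l) = 0 \<longrightarrow> a k / b k = a l / b l"
        using bd[OF subsetD[OF sub k] kz] by (elim exE conjE)
      show "\<exists>w. (\<forall>k\<in>M'. 0 \<le> pairing r w (wt k)) \<and> pairing r w (wt k) = 0 \<and>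
        (\<forall>k\<in>M'. \<forall>l\<in>M'. pairing r w (wt k) = 0 \<longrightarrow> pairing r w (wt l) = 0 \<longrightarrow> a k / b k = a l / b l)"
        by (intro exI[of _ w] conjI ballI w(1,2)[rule_format] impI w(3)[rule_format]) (auto intro: subsetD[OF sub])
    qed (use i j M'_def in simp_all)
    thus ?thesis by (simp add: c_def)
  qed
  show ?case
  proof (rule ccontr)
    assume contra: "a i / b i \<noteq> a j / b j"
    \<comment> \<open>The functional supplied for \<open>k\<close> vanishes at \<open>k\<close>;
      were it constant on \<open>M\<close>, it would vanish on all of \<open>M\<close> and make the
      ratio constant.\<close>
    have face: "\<exists>f\<in>range ev. \<not> f constant_on M \<and> k \<in> argmin_on M f" if k: "k \<in> M" "k \<noteq> z" for k
    proof -
      obtain w where w: "\<forall>k\<in>M. 0 \<le> ev w k" "ev w k = 0"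
        "\<forall>k\<in>M. \<forall>l\<in>M. ev w k = 0 \<longrightarrow> ev w l = 0 \<longrightarrow> a k / b k = a l / b l"
        unfolding ev_def using bd[OF k] by (elim exE conjE)
      have "\<not> ev w constant_on M"
      proof
        assume "ev w constant_on M"
        then obtain y where y: "\<And>l. l \<in> M \<Longrightarrow> ev w l = y" by (auto simp: constant_on_def)
        hence "y = 0" using w(2) k(1) by metis
        hence "a i / b i = a j / b j" using w(3) y less.prems(8,9) by blast
        thus False using contra by simp
      qed
      moreover have "k \<in> argmin_on M (ev w)" using w k by (simp add: argmin_on_def)
      ultimately show ?thesis by blast
    qed
    show False
    proof (cases "\<exists>i\<in>M. \<exists>j\<in>M. i \<noteq> z \<and> j \<noteq> z \<and> c i \<noteq> c j")
      case False
      hence same: "c k = c l" if "k \<in> M" "l \<in> M" "k \<noteq> z" "l \<noteq> z" for k l using that by blast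
      have zM: "z \<in> M" using contra same less.prems(8,9) unfolding c_def by metis
      obtain k where k: "k \<in> M" "k \<noteq> z" "c k \<noteq> c z"
        using contra same less.prems(8,9) unfolding c_def by metis
      define \<rho> where "\<rho> = c k"
      have ab: "a l = \<rho> * b l" if "l \<in> M" "l \<noteq> z" for l
        using same[OF that(1) k(1) that(2) k(2)] nz[OF that] by (simp add: \<rho>_def c_def field_simps)
      have neqz: "a z \<noteq> \<rho> * b z"
        using k(3) nz'[OF zM] by (auto simp: \<rho>_def c_def)
      \<comment> \<open>Whichever of \<open>a z\<close>, \<open>b z\<close> is non-zero belongs to a
        Laurent polynomial with at least the terms \<open>k\<close> and \<open>z\<close>, hence with
        a zero, which is then common. There, subtracting \<open>\<rho>\<close> times the second sum
        from the first leaves only the term of \<open>z\<close>.\<close>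
      have "\<exists>s\<in>torus r. char_sum r wt a M s = 0 \<and> char_sum r wt b M s = 0"
      proof (cases "a z = 0")
        case True
        hence "b z \<noteq> 0" using nz'[OF zM] by simp
        hence "\<exists>s\<in>torus r. char_sum r wt b M s = 0"
          using char_sum_has_zero[OF fin inj lat k(1) _ zM, of b] nz[OF k(1,2)] k(2) by blast
        thus ?thesis using eq by (auto simp: same_zeros_def)
      next
        case False
        hence "\<exists>s\<in>torus r. char_sum r wt a M s = 0"
          using char_sum_has_zero[OF fin inj lat k(1) _ zM, of a] nz[OF k(1,2)] k(2) by blast
        thus ?thesis using eq by (auto simp: same_zeros_def)
      qed
      then obtain s where s: "s \<in> torus r" "char_sum r wt a M s = 0" "char_sum r wt b M s = 0" by blast
      have "char_sum r wt a M s - \<rho> * char_sum r wt b M s =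
          (\<Sum>l\<in>M. (a l - \<rho> * b l) * char_eval r (wt l) s)"
        by (simp add: char_sum_def sum_subtractf sum_distrib_left algebra_simps)
      also have "\<dots> = (\<Sum>l\<in>{z}. (a l - \<rho> * b l) * char_eval r (wt l) s)"
        by (rule sum.mono_neutral_right) (use fin zM ab in auto)
      finally have "(a z - \<rho> * b z) * char_eval r (wt z) s = 0" using s by simp
      thus False using neqz char_eval_nonzero[OF s(1)] by simp
    next
      case True
      then obtain i j where ij: "i \<in> M" "j \<in> M" "i \<noteq> z" "j \<noteq> z" "c i \<noteq> c j" by blast
      have neM: "M \<noteq> {}" using ij by blast
      obtain f where f: "f \<in> range ev" "\<not> f constant_on M" "i \<in> argmin_on M f"
        using face[OF ij(1,3)] by blast
      obtain g where g: "g \<in> range ev" "\<not> g constant_on M" "j \<in> argmin_on M g"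
        using face[OF ij(2,4)] by blast
      \<comment> \<open>Minimisers with different ratios cannot be linked through proper faces, so
        some non-trivial non-negative combination of their functionals is constant on
        \<open>M\<close>.\<close>
      have conn: "\<exists>\<alpha> \<beta>. 0 \<le> \<alpha> \<and> 0 \<le> \<beta> \<and> (\<alpha>, \<beta>) \<noteq> (0, 0) \<and> (\<lambda>k. \<alpha> * f k + \<beta> * g k) constant_on M"
        if fg: "f \<in> range ev" "g \<in> range ev" "i \<in> argmin_on M f" "j \<in> argmin_on M g" "c i \<noteq> c j" for f g i j
      proof (rule ccontr)
        assume no: "\<not> ?thesis"
        have "c i = c j"
        proof (rule argmin_class_connected[of M "range ev" c f g])
          fix f g \<alpha> \<beta> assume "f \<in> range ev" "g \<in> range ev"
          thus "(\<lambda>k. \<alpha> * f k + \<beta> * g k) \<in> range ev" by (rule closed)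
        next
          fix f i j assume "f \<in> range ev" "\<not> f constant_on M" "i \<in> argmin_on M f" "j \<in> argmin_on M f"
          thus "c i = c j" by (rule hom)
        next
          fix \<alpha> \<beta> :: int assume "0 \<le> \<alpha>" "0 \<le> \<beta>" "(\<alpha>, \<beta>) \<noteq> (0, 0)"
          with no show "\<not> (\<lambda>k. \<alpha> * f k + \<beta> * g k) constant_on M" by blast
        qed (use fin neM fg in simp_all)
        thus False using fg(5) by simp
      qed
      have scaled_const: "h constant_on M" if "(\<lambda>k. \<beta> * h k) constant_on M" "\<beta> \<noteq> 0"
        for h and \<beta> :: int
        using that unfolding constant_on_def by (metis mult_cancel_left)
      \<comment> \<open>Both coefficients are positive because neither \<open>f\<close> nor
        \<open>g\<close> is constant: on \<open>M\<close> the two run in opposite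
        directions.\<close>
      obtain \<alpha> \<beta> y where opp: "0 < \<alpha>" "0 < \<beta>" "\<And>k. k \<in> M \<Longrightarrow> \<alpha> * f k + \<beta> * g k = y"
      proof -
        obtain \<alpha> \<beta> where ab: "0 \<le> \<alpha>" "0 \<le> \<beta>" "(\<alpha>, \<beta>) \<noteq> (0, 0)"
          and cst: "(\<lambda>k. \<alpha> * f k + \<beta> * g k) constant_on M"
          using conn[OF f(1) g(1) f(3) g(3) ij(5)] by blast
        have "\<alpha> \<noteq> 0" using ab cst scaled_const[of \<beta> g] g(2) by auto
        moreover have "\<beta> \<noteq> 0" using ab cst scaled_const[of \<alpha> f] f(2) by auto
        ultimately show thesis using that[of \<alpha> \<beta>] ab cst by (auto simp: constant_on_def)
      qed
      \<comment> \<open>The ratio at a minimiser of \<open>h\<close> differs from that at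
        \<open>i\<close> or at \<open>j\<close>, so \<open>h\<close> can be played against
        \<open>f\<close> or against \<open>g\<close>. Hence every functional is on \<open>M\<close>
        an affine function of \<open>f\<close>, and the characters lie on a line.\<close>
      have affine: "\<exists>\<gamma> \<delta> y. \<delta> \<noteq> 0 \<and> (\<forall>k\<in>M. \<gamma> * f k + \<delta> * h k = y)" if h: "h \<in> range ev" for h
      proof -
        obtain l where l: "l \<in> argmin_on M h" using argmin_on_nonempty[OF fin neM] by blast
        show ?thesis
        proof (cases "c i = c l")
          case False
          then obtain x x' where x: "0 \<le> x" "0 \<le> x'" "(x, x') \<noteq> (0, 0)"
            and cst: "(\<lambda>k. x * f k + x' * h k) constant_on M"
            using conn[OF f(1) h f(3) l] by blast
          moreover have "x' \<noteq> 0" using x cst scaled_const[of x f] f(2) by auto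
          ultimately show ?thesis by (auto simp: constant_on_def)
        next
          case True
          hence "c l \<noteq> c j" using ij(5) by simp
          then obtain x x' where x: "0 \<le> x" "0 \<le> x'" "(x, x') \<noteq> (0, 0)"
            and "(\<lambda>k. x * h k + x' * g k) constant_on M"
            using conn[OF h g(1) l g(3)] by blast
          then obtain y' where y': "\<And>k. k \<in> M \<Longrightarrow> x * h k + x' * g k = y'"
            unfolding constant_on_def by metis
          have "x \<noteq> 0"
            using x y' scaled_const[of x' g] g(2) by (auto simp: constant_on_def)
          moreover have "(- x' * \<alpha>) * f k + (\<beta> * x) * h k = \<beta> * y' - x' * y" if "k \<in> M" for k
            unfolding y'[OF that, symmetric] opp(3)[OF that, symmetric] by (simp add: algebra_simps)
          ultimately show ?thesis using opp(2)
            by (intro exI[of _ "- x' * \<alpha>"] exI[of _ "\<beta> * x"] exI[of _ "\<beta> * y' - x' * y"]) auto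
        qed
      qed
      \<comment> \<open>The coordinate functions are affine in \<open>f\<close> as well, so
        \<open>f\<close> determines the character.\<close>
      have inj_f: "k = l" if kl: "k \<in> M" "l \<in> M" "f k = f l" for k l
      proof (rule inj_onD[OF inj _ kl(1,2)], rule ext)
        fix t
        show "wt k t = wt l t"
        proof (cases "t < r")
          case False
          thus ?thesis using lat[OF kl(1)] lat[OF kl(2)] by (simp add: char_lattice_def)
        next
          case True
          have coord: "ev (\<lambda>j. if j = t then 1 else 0) k = wt k t" for k
            using True by (simp add: ev_def pairing_def if_distrib[of "\<lambda>x. x * _"] cong: if_cong)
          have "ev (\<lambda>j. if j = t then 1 else 0) k = ev (\<lambda>j. if j = t then 1 else 0) l"
          proof -
            obtain \<gamma> \<delta> y where "\<delta> \<noteq> 0"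
              "\<forall>k\<in>M. \<gamma> * f k + \<delta> * ev (\<lambda>j. if j = t then 1 else 0) k = y"
              using affine by blast
            thus ?thesis using kl by (metis add_left_cancel mult_cancel_left)
          qed
          thus ?thesis by (simp add: coord)
        qed
      qed
      have imin: "f i \<le> f k" if "k \<in> M" for k using f(3) that by (simp add: argmin_on_def)
      have jmax: "f k \<le> f j" if k: "k \<in> M" for k
      proof -
        have "\<beta> * g j \<le> \<beta> * g k" using g(3) k opp(2) by (simp add: argmin_on_def)
        hence "\<alpha> * f k \<le> \<alpha> * f j" using opp(3)[OF k] opp(3)[OF ij(2)] by linarith
        thus ?thesis using opp(1) by simp
      qed
      \<comment> \<open>An index other than \<open>z\<close> minimises a non-constant affine
        function of \<open>f\<close>, so it sits at an end of the segment.\<close>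
      have ends: "l = i \<or> l = j" if l: "l \<in> M" "l \<noteq> z" for l
      proof -
        obtain h where h: "h \<in> range ev" "\<not> h constant_on M" "l \<in> argmin_on M h"
          using face[OF l] by blast
        obtain \<gamma> \<delta> y where d: "\<delta> \<noteq> 0" and y: "\<And>k. k \<in> M \<Longrightarrow> \<gamma> * f k + \<delta> * h k = y"
          using affine[OF h(1)] by metis
        have lmin: "h l \<le> h k" if "k \<in> M" for k using h(3) that by (simp add: argmin_on_def)
        have "\<gamma> \<noteq> 0"
          using y scaled_const[of \<delta> h] d h(2) by (auto simp: constant_on_def)
        have extreme: "\<gamma> * f l \<le> \<gamma> * f k \<and> \<delta> < 0 \<or> \<gamma> * f k \<le> \<gamma> * f l \<and> 0 < \<delta>" if k: "k \<in> M" for k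
        proof (cases "\<delta> > 0")
          case True
          hence "\<delta> * h l \<le> \<delta> * h k" using lmin[OF k] by simp
          thus ?thesis using y[OF k] y[OF l(1)] True by linarith
        next
          case False
          hence "\<delta> * h k \<le> \<delta> * h l" using lmin[OF k] d by (simp add: mult_left_mono_neg)
          thus ?thesis using y[OF k] y[OF l(1)] False d by linarith
        qed
        have "f l \<le> f i \<or> f j \<le> f l"
          using extreme[OF ij(1)] extreme[OF ij(2)] \<open>\<gamma> \<noteq> 0\<close>
          by (cases "\<gamma> > 0"; cases "\<delta> > 0") (auto simp: mult_le_cancel_left)
        hence "f l = f i \<or> f l = f j" using imin[OF l(1)] jmax[OF l(1)] by linarith
        thus ?thesis using inj_f l(1) ij(1,2) by blast
      qed
      have ne: "i \<noteq> j" using ij(5) by auto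
      have nzij: "a i \<noteq> 0" "a j \<noteq> 0" "b i \<noteq> 0" "b j \<noteq> 0" using nz ij by auto
      have "a i * b j = a j * b i"
      proof (cases "z \<in> M")
        case False
        hence M: "M = {i, j}" using ends ij by blast
        have "wt i \<noteq> wt j" using inj ij ne by (auto dest: inj_onD)
        thus ?thesis
          using same_zeros_proportional_binomial[of wt i j r a b] lat ij nzij eq M by blast
      next
        case True
        hence M: "M = {i, z, j}" using ends ij by blast
        obtain w where w: "f = ev w" using f(1) by auto
        have "f i < f z" "f z < f j"
          using imin[OF True] jmax[OF True] inj_f[OF ij(1) True] inj_f[OF True ij(2)] ij(3,4)
          by (auto simp: less_le)
        thus ?thesis
          using same_zeros_proportional_trinomial[of r w wt i z j a b] nzij eq M by (simp add: w ev_def)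
      qed
      hence "c i = c j" using nzij by (simp add: c_def field_simps)
      thus False using ij(5) by simp
    qed
  qed
qed

section \<open>Rational cones\<close>

lemma sum_fun_apply: "(\<Sum>i\<in>A. f i) x = (\<Sum>i\<in>A. f i x)"
  by (induction A rule: infinite_finite_induct) auto

definition qdot :: "nat \<Rightarrow> (nat \<Rightarrow> rat) \<Rightarrow> (nat \<Rightarrow> rat) \<Rightarrow> rat" where
  "qdot r u x = (\<Sum>j<r. u j * x j)"

definition qspace :: "nat \<Rightarrow> (nat \<Rightarrow> rat) set" where
  "qspace r = {x. \<forall>j\<ge>r. x j = 0}"

lemma qdot_sum:
  assumes "\<And>j. x j = (\<Sum>i\<in>A. c i * v i j)"
  shows "qdot r u x = (\<Sum>i\<in>A. c i * qdot r u (v i))"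
proof -
  have "qdot r u x = (\<Sum>j<r. \<Sum>i\<in>A. c i * (u j * v i j))"
    by (simp add: qdot_def assms sum_distrib_left mult_ac)
  thus ?thesis by (subst (asm) sum.swap) (simp add: qdot_def sum_distrib_left)
qed

lemma qdot_lincomb: "qdot r u (\<lambda>j. a * x j + b * y j) = a * qdot r u x + b * qdot r u y"
  by (simp add: qdot_def sum.distrib sum_distrib_left algebra_simps)

lemma qdot_lincomb_left: "qdot r (\<lambda>j. a * u j + b * v j) x = a * qdot r u x + b * qdot r v x"
  by (simp add: qdot_def sum.distrib sum_distrib_left algebra_simps)

lemma qdot_uminus: "qdot r u (\<lambda>j. - x j) = - qdot r u x"
  by (simp add: qdot_def sum_negf)

text \<open>Farkas' lemma. If the separating functional \<open>w\<close> found for the smaller family is negative on the new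
  generator \<open>v a\<close>, one projects along \<open>v a\<close> to the kernel of \<open>w\<close> and separates there.\<close>

lemma farkas:
  assumes "finite A" and "\<And>i. i \<in> A \<Longrightarrow> v i \<in> qspace r" and "b \<in> qspace r"
    and "\<nexists>q. (\<forall>i\<in>A. 0 \<le> q i) \<and> (\<forall>j. b j = (\<Sum>i\<in>A. q i * v i j))"
  shows "\<exists>w. (\<forall>i\<in>A. 0 \<le> qdot r w (v i)) \<and> qdot r w b < 0"
  using assms
proof (induction A arbitrary: v b rule: finite_induct)
  case empty
  then obtain j where j: "b j \<noteq> 0" by auto
  hence "j < r" using empty.prems(2) by (auto simp: qspace_def not_le[symmetric])
  hence "0 < (\<Sum>j<r. b j * b j)"
    using j by (intro sum_pos2[of _ j]) (auto simp: zero_less_mult_iff not_less less_le)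
  hence "qdot r (\<lambda>j. - b j) b < 0" by (simp add: qdot_def sum_negf)
  thus ?case by auto
next
  case (insert a A)
  have "\<nexists>q. (\<forall>i\<in>A. 0 \<le> q i) \<and> (\<forall>j. b j = (\<Sum>i\<in>A. q i * v i j))"
  proof safe
    fix q assume q: "\<forall>i\<in>A. 0 \<le> q i" "\<forall>j. b j = (\<Sum>i\<in>A. q i * v i j)"
    have eq: "b j = (\<Sum>i\<in>insert a A. (q(a := 0)) i * v i j)" for j
    proof -
      have "(\<Sum>i\<in>A. (q(a := 0)) i * v i j) = (\<Sum>i\<in>A. q i * v i j)"
        by (rule sum.cong) (use insert.hyps in auto)
      thus ?thesis using insert.hyps q(2) by simp
    qed
    have "\<exists>q. (\<forall>i\<in>insert a A. 0 \<le> q i) \<and> (\<forall>j. b j = (\<Sum>i\<in>insert a A. q i * v i j))"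
      by (rule exI[of _ "q(a := 0)"], intro conjI allI eq) (use q(1) in simp)
    thus False using insert.prems(3) by simp
  qed
  then obtain w where w: "\<forall>i\<in>A. 0 \<le> qdot r w (v i)" "qdot r w b < 0"
    using insert.IH[of v b] insert.prems by auto
  show ?case
  proof (cases "0 \<le> qdot r w (v a)")
    case True
    thus ?thesis using w by auto
  next
    case False
    define \<kappa> where "\<kappa> = qdot r w (v a)"
    have neg: "\<kappa> < 0" using False by (simp add: \<kappa>_def)
    define \<pi> where "\<pi> x = (\<lambda>j. 1 * x j + (- (qdot r w x / \<kappa>)) * v a j)" for x
    have "\<nexists>q. (\<forall>i\<in>A. 0 \<le> q i) \<and> (\<forall>j. \<pi> b j = (\<Sum>i\<in>A. q i * \<pi> (v i) j))"
    proof safe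
      fix q assume q: "\<forall>i\<in>A. 0 \<le> q i" "\<forall>j. \<pi> b j = (\<Sum>i\<in>A. q i * \<pi> (v i) j)"
      define t where "t = qdot r w b / \<kappa> - (\<Sum>i\<in>A. q i * (qdot r w (v i) / \<kappa>))"
      have "(\<Sum>i\<in>A. q i * (qdot r w (v i) / \<kappa>)) \<le> 0"
        by (rule sum_nonpos) (use q w neg in \<open>auto intro!: mult_nonneg_nonpos divide_nonneg_neg\<close>)
      moreover have "qdot r w b / \<kappa> \<ge> 0" using w(2) neg by (simp add: divide_nonpos_neg)
      ultimately have t: "0 \<le> t" by (simp add: t_def)
      have eq: "b j = (\<Sum>i\<in>insert a A. (q(a := t)) i * v i j)" for j
      proof -
        have "b j = (\<Sum>i\<in>A. q i * \<pi> (v i) j) + qdot r w b / \<kappa> * v a j"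
          unfolding q(2)[rule_format, symmetric] by (simp add: \<pi>_def)
        also have "\<dots> = (\<Sum>i\<in>A. q i * v i j) + t * v a j"
          by (simp add: \<pi>_def t_def sum_subtractf sum_distrib_left algebra_simps)
        also have "(\<Sum>i\<in>A. q i * v i j) = (\<Sum>i\<in>A. (q(a := t)) i * v i j)"
          using insert.hyps by (intro sum.cong) auto
        finally show ?thesis using insert.hyps by simp
      qed
      have "\<exists>q. (\<forall>i\<in>insert a A. 0 \<le> q i) \<and> (\<forall>j. b j = (\<Sum>i\<in>insert a A. q i * v i j))"
        by (rule exI[of _ "q(a := t)"], intro conjI allI eq) (use q(1) t in simp)
      thus False using insert.prems(3) by simp
    qed
    moreover have "\<pi> x \<in> qspace r" if "x \<in> qspace r" for x
      using that insert.prems(1)[of a] by (simp add: qspace_def \<pi>_def)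
    ultimately obtain w' where w': "\<forall>i\<in>A. 0 \<le> qdot r w' (\<pi> (v i))" "qdot r w' (\<pi> b) < 0"
      using insert.IH[of "\<lambda>i. \<pi> (v i)" "\<pi> b"] insert.prems by auto
    define w'' where "w'' = (\<lambda>j. 1 * w' j + (- (qdot r w' (v a) / \<kappa>)) * w j)"
    have eq: "qdot r w'' x = qdot r w' (\<pi> x)" for x
      unfolding w''_def \<pi>_def qdot_lincomb qdot_lincomb_left by simp
    have "\<pi> (v a) = (\<lambda>j. 0)" using neg by (simp add: \<pi>_def \<kappa>_def)
    hence "qdot r w'' (v a) = 0" unfolding eq by (simp add: qdot_def)
    thus ?thesis using w' by (intro exI[of _ w'']) (simp add: eq)
  qed
qed

text \<open>This is Farkas' lemma for the generators together with their negatives, tagged by a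
  Boolean: the cone becomes the span, and a functional non-negative on both signs is zero
  there.\<close>

lemma separate_from_span:
  assumes fin: "finite A" and v: "\<And>i. i \<in> A \<Longrightarrow> v i \<in> qspace r" and x: "x \<in> qspace r"
    and no: "\<nexists>c. \<forall>j. x j = (\<Sum>i\<in>A. c i * v i j)"
  shows "\<exists>w. (\<forall>i\<in>A. qdot r w (v i) = 0) \<and> qdot r w x \<noteq> 0"
proof -
  define v' where "v' = (\<lambda>(i, s). if s then v i else (\<lambda>j. - v i j))"
  have "\<nexists>q. (\<forall>p\<in>A \<times> UNIV. 0 \<le> q p) \<and> (\<forall>j. x j = (\<Sum>p\<in>A \<times> UNIV. q p * v' p j))"
  proof safe
    fix q assume q: "\<forall>j. x j = (\<Sum>p\<in>A \<times> UNIV. q p * v' p j)"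
    have eq: "x j = (\<Sum>i\<in>A. (q (i, True) - q (i, False)) * v i j)" for j
      unfolding q[rule_format] sum.cartesian_product'
      by (simp add: UNIV_bool v'_def algebra_simps)
    have "\<exists>c. \<forall>j. x j = (\<Sum>i\<in>A. c i * v i j)"
      by (rule exI[of _ "\<lambda>i. q (i, True) - q (i, False)"], rule allI, rule eq)
    thus False using no by simp
  qed
  moreover have "v' p \<in> qspace r" if "p \<in> A \<times> UNIV" for p
    using that v by (auto simp: v'_def qspace_def)
  ultimately obtain w where w: "\<forall>p\<in>A \<times> UNIV. 0 \<le> qdot r w (v' p)" "qdot r w x < 0"
    using farkas[of "A \<times> (UNIV :: bool set)" v' r x] fin x by auto
  have "qdot r w (v i) = 0" if "i \<in> A" for i
    using w(1)[rule_format, of "(i, True)"] w(1)[rule_format, of "(i, False)"] that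
    by (simp add: v'_def qdot_uminus)
  thus ?thesis using w(2) by (metis less_irrefl)
qed

text \<open>A generator dependent on the others is eliminated, which is why \<open>d\<close> may
  differ from \<open>c\<close>; the coefficient of an independent one is read off by a functional
  that kills the others, so smallness of the vector bounds it.\<close>

lemma bounded_coefficients:
  assumes "finite A" and "\<And>i. i \<in> A \<Longrightarrow> v i \<in> qspace r"
  shows "\<exists>C\<ge>0. \<forall>e\<ge>0. \<forall>c. (\<forall>j. \<bar>\<Sum>i\<in>A. c i * v i j\<bar> \<le> e) \<longrightarrow>
    (\<exists>d. (\<forall>j. (\<Sum>i\<in>A. d i * v i j) = (\<Sum>i\<in>A. c i * v i j)) \<and> (\<forall>i\<in>A. \<bar>d i\<bar> \<le> C * e))"
  using assms
proof (induction A rule: finite_induct)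
  case empty
  show ?case by (rule exI[of _ 0]) auto
next
  case (insert a A)
  obtain C where C: "C \<ge> 0" and IH: "\<And>e c. e \<ge> 0 \<Longrightarrow> (\<And>j. \<bar>\<Sum>i\<in>A. c i * v i j\<bar> \<le> e) \<Longrightarrow>
    \<exists>d. (\<forall>j. (\<Sum>i\<in>A. d i * v i j) = (\<Sum>i\<in>A. c i * v i j)) \<and> (\<forall>i\<in>A. \<bar>d i\<bar> \<le> C * e)"
  proof -
    have "\<exists>C\<ge>0. \<forall>e\<ge>0. \<forall>c. (\<forall>j. \<bar>\<Sum>i\<in>A. c i * v i j\<bar> \<le> e) \<longrightarrow>
        (\<exists>d. (\<forall>j. (\<Sum>i\<in>A. d i * v i j) = (\<Sum>i\<in>A. c i * v i j)) \<and> (\<forall>i\<in>A. \<bar>d i\<bar> \<le> C * e))"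
      by (rule insert.IH) (simp add: insert.prems)
    thus thesis using that by (elim exE conjE) (simp only: atomize_all atomize_imp, blast)
  qed
  have upd: "(\<Sum>i\<in>insert a A. (d(a := t)) i * v i j) = t * v a j + (\<Sum>i\<in>A. d i * v i j)" for d t j
  proof -
    have "(\<Sum>i\<in>A. (d(a := t)) i * v i j) = (\<Sum>i\<in>A. d i * v i j)"
      by (rule sum.cong) (use insert.hyps in auto)
    thus ?thesis using insert.hyps by simp
  qed
  show ?case
  proof (cases "\<exists>k. \<forall>j. v a j = (\<Sum>i\<in>A. k i * v i j)")
    case True
    then obtain k where k: "\<And>j. v a j = (\<Sum>i\<in>A. k i * v i j)" by blast
    have red: "(\<Sum>i\<in>insert a A. c i * v i j) = (\<Sum>i\<in>A. (c i + c a * k i) * v i j)" for c j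
      using insert.hyps by (simp add: k sum.distrib sum_distrib_left algebra_simps)
    show ?thesis
    proof (intro exI[of _ C] conjI allI impI C)
      fix e :: rat and c assume e: "0 \<le> e" "\<forall>j. \<bar>\<Sum>i\<in>insert a A. c i * v i j\<bar> \<le> e"
      then obtain d where d: "\<forall>j. (\<Sum>i\<in>A. d i * v i j) = (\<Sum>i\<in>A. (c i + c a * k i) * v i j)"
        "\<forall>i\<in>A. \<bar>d i\<bar> \<le> C * e"
        using IH[of e "\<lambda>i. c i + c a * k i"] unfolding red by blast
      show "\<exists>d. (\<forall>j. (\<Sum>i\<in>insert a A. d i * v i j) = (\<Sum>i\<in>insert a A. c i * v i j)) \<and>
          (\<forall>i\<in>insert a A. \<bar>d i\<bar> \<le> C * e)"
        by (rule exI[of _ "d(a := 0)"], unfold upd red) (use d e C in auto)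
    qed
  next
    case False
    then obtain w where w: "\<forall>i\<in>A. qdot r w (v i) = 0" "qdot r w (v a) \<noteq> 0"
      using separate_from_span[of A v r "v a"] insert by auto
    define W where "W = (\<Sum>j<r. \<bar>w j\<bar>)"
    define D where "D = W / \<bar>qdot r w (v a)\<bar>"
    define B where "B = (\<Sum>j<r. \<bar>v a j\<bar>)"
    have nonneg: "0 \<le> W" "0 \<le> D" "0 \<le> B" by (simp_all add: W_def D_def B_def sum_nonneg)
    have vB: "\<bar>v a j\<bar> \<le> B" for j
    proof (cases "j < r")
      case True
      thus ?thesis unfolding B_def by (intro member_le_sum[of j _ "\<lambda>j. \<bar>v a j\<bar>"]) auto
    next
      case False
      thus ?thesis using insert.prems[of a] nonneg by (simp add: qspace_def)
    qed
    \<comment> \<open>\<open>D * e\<close> bounds the coefficient of \<open>v a\<close>, so removing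
      that term enlarges the bound \<open>e\<close> to at most \<open>e * (1 + D * B)\<close>; the
      summand \<open>D\<close> accounts for \<open>c a\<close> itself.\<close>
    show ?thesis
    proof (intro exI[of _ "C * (1 + D * B) + D"] conjI allI impI)
      show "0 \<le> C * (1 + D * B) + D" using C nonneg by simp
      fix e :: rat and c assume e: "0 \<le> e" and small: "\<forall>j. \<bar>\<Sum>i\<in>insert a A. c i * v i j\<bar> \<le> e"
      define y where "y j = (\<Sum>i\<in>insert a A. c i * v i j)" for j
      have "qdot r w y = (\<Sum>i\<in>insert a A. c i * qdot r w (v i))"
        by (rule qdot_sum) (simp add: y_def)
      hence "qdot r w y = c a * qdot r w (v a)" using w insert.hyps by simp
      moreover have "\<bar>qdot r w y\<bar> \<le> W * e"
      proof -
        have "\<bar>qdot r w y\<bar> \<le> (\<Sum>j<r. \<bar>w j\<bar> * \<bar>y j\<bar>)"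
          unfolding qdot_def by (rule order_trans[OF sum_abs]) (simp add: abs_mult)
        also have "\<dots> \<le> (\<Sum>j<r. \<bar>w j\<bar> * e)"
          by (rule sum_mono) (use small in \<open>auto simp: y_def intro: mult_left_mono\<close>)
        finally show ?thesis by (simp add: W_def sum_distrib_right)
      qed
      ultimately have ca: "\<bar>c a\<bar> \<le> D * e"
        using w(2) by (simp add: D_def abs_mult field_simps)
      have "\<bar>\<Sum>i\<in>A. c i * v i j\<bar> \<le> e * (1 + D * B)" for j
      proof -
        have "(\<Sum>i\<in>A. c i * v i j) = y j - c a * v a j" using insert.hyps by (simp add: y_def)
        moreover have "\<bar>y j\<bar> \<le> e" using small by (simp add: y_def)
        moreover have "\<bar>c a * v a j\<bar> \<le> (D * e) * B"
          unfolding abs_mult by (intro mult_mono ca vB) (use nonneg e in auto)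
        ultimately show ?thesis by (simp add: algebra_simps)
      qed
      moreover have "0 \<le> e * (1 + D * B)" using e nonneg by simp
      ultimately obtain d where d: "\<forall>j. (\<Sum>i\<in>A. d i * v i j) = (\<Sum>i\<in>A. c i * v i j)"
        "\<forall>i\<in>A. \<bar>d i\<bar> \<le> C * (e * (1 + D * B))"
        using IH[of "e * (1 + D * B)" c] by blast
      have "\<bar>d i\<bar> \<le> (C * (1 + D * B) + D) * e" if "i \<in> A" for i
      proof -
        have "0 \<le> D * e" using e nonneg by simp
        thus ?thesis using d(2)[rule_format, OF that] by (simp add: algebra_simps)
      qed
      moreover have "\<bar>c a\<bar> \<le> (C * (1 + D * B) + D) * e"
      proof -
        have "0 \<le> C * (1 + D * B) * e" using e nonneg C by simp
        thus ?thesis using ca by (simp add: algebra_simps)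
      qed
      ultimately show "\<exists>d. (\<forall>j. (\<Sum>i\<in>insert a A. d i * v i j) = (\<Sum>i\<in>insert a A. c i * v i j)) \<and>
          (\<forall>i\<in>insert a A. \<bar>d i\<bar> \<le> (C * (1 + D * B) + D) * e)"
        by (intro exI[of _ "d(a := c a)"], unfold upd) (use d insert.hyps in auto)
    qed
  qed
qed

lemma weight_cone_iff:
  "x \<in> weight_cone wt \<longleftrightarrow>
     (\<exists>q. (\<forall>i. 0 \<le> q i) \<and> (\<forall>j. x j = (\<Sum>i\<in>UNIV. q i * rat_char (wt i) j)))"
  by (auto simp: weight_cone_def qscale_def sum_fun_apply fun_eq_iff)

lemma qdot_rat_char: "qdot r (\<lambda>j. of_int (u j)) (rat_char m) = of_int (pairing r u m)"
  by (simp add: qdot_def rat_char_def pairing_def)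

lemma rat_char_in_qspace: "m \<in> char_lattice r \<Longrightarrow> rat_char m \<in> qspace r"
  by (simp add: rat_char_def qspace_def char_lattice_def)

text \<open>This turns rational functionals into cocharacters and rational relations between
  characters into monomial ones.\<close>

lemma common_denominator:
  fixes f :: "'a \<Rightarrow> rat"
  assumes "finite A"
  shows "\<exists>D::int. D > 0 \<and> (\<exists>g. \<forall>i\<in>A. of_int D * f i = of_int (g i))"
  using assms
proof (induction A rule: finite_induct)
  case empty
  show ?case by (rule exI[of _ 1]) auto
next
  case (insert a A)
  then obtain D g where D: "D > 0" "\<And>i. i \<in> A \<Longrightarrow> of_int D * f i = of_int (g i)" by blast
  obtain p q where pq: "quotient_of (f a) = (p, q)" by force
  hence q: "q > 0" and fa: "f a = of_int p / of_int q"
    by (auto intro: quotient_of_denom_pos quotient_of_div)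
  show ?case
  proof (intro exI[of _ "D * q"] conjI exI[of _ "\<lambda>i. if i = a then D * p else q * g i"] ballI)
    fix i assume "i \<in> insert a A"
    thus "of_int (D * q) * f i = of_int (if i = a then D * p else q * g i)"
      using D(2)[of i] q fa by (auto simp: mult_ac)
  qed (use D q in simp)
qed

text \<open>A sum of non-negative terms vanishes only if every term does, so only generators on the
  face contribute.\<close>

lemma cone_face_iff_supported:
  fixes wt :: "'n::finite \<Rightarrow> nat \<Rightarrow> int"
  assumes u: "\<And>i. 0 \<le> qdot r u (rat_char (wt i))"
  defines "I \<equiv> {i. qdot r u (rat_char (wt i)) = 0}"
  shows "x \<in> weight_cone wt \<and> qdot r u x = 0 \<longleftrightarrow>
    (\<exists>q. (\<forall>i\<in>I. 0 \<le> q i) \<and> (\<forall>j. x j = (\<Sum>i\<in>I. q i * rat_char (wt i) j)))"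
    (is "?l \<longleftrightarrow> ?r")
proof
  assume ?l
  then obtain q where q: "\<And>i. 0 \<le> q i" "\<And>j. x j = (\<Sum>i\<in>UNIV. q i * rat_char (wt i) j)"
    by (auto simp: weight_cone_iff)
  have "(\<Sum>i\<in>UNIV. q i * qdot r u (rat_char (wt i))) = 0"
    using qdot_sum[OF q(2), of r u] \<open>?l\<close> by simp
  hence "q i * qdot r u (rat_char (wt i)) = 0" for i
    by (subst (asm) sum_nonneg_eq_0_iff) (use q u in auto)
  hence "q i = 0" if "i \<notin> I" for i using that by (auto simp: I_def)
  hence "x j = (\<Sum>i\<in>I. q i * rat_char (wt i) j)" for j
    unfolding q(2) by (intro sum.mono_neutral_right) auto
  thus ?r using q(1) by blast
next
  assume ?r
  then obtain q where q: "\<And>i. i \<in> I \<Longrightarrow> 0 \<le> q i" "\<And>j. x j = (\<Sum>i\<in>I. q i * rat_char (wt i) j)" by blast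
  have "x j = (\<Sum>i\<in>UNIV. (if i \<in> I then q i else 0) * rat_char (wt i) j)" for j
    unfolding q(2) by (intro sum.mono_neutral_cong_left) auto
  hence "x \<in> weight_cone wt"
    unfolding weight_cone_iff using q(1) by (intro exI[of _ "\<lambda>i. if i \<in> I then q i else 0"]) auto
  moreover have "qdot r u x = 0"
    unfolding qdot_sum[OF q(2)] by (rule sum.neutral) (simp add: I_def)
  ultimately show ?l by blast
qed

text \<open>If no supporting functional of the face separates \<open>\<chi>\<^sub>i\<close> from one of the other generators, then by
  Farkas the negative of every generator is a non-negative combination of the generators and
  \<open>-\<chi>\<^sub>i\<close>, so a small perturbation of \<open>\<chi>\<^sub>i\<close> within the span stays in the face.\<close>

lemma supporting_functional_if_not_interior:
  fixes wt :: "'n::finite \<Rightarrow> nat \<Rightarrow> int"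
  assumes lat: "\<And>i. wt i \<in> char_lattice r"
    and u: "\<And>i. 0 \<le> qdot r u (rat_char (wt i))"
    and I: "I = {i. qdot r u (rat_char (wt i)) = 0}"
    and F: "F = {x \<in> weight_cone wt. qdot r u x = 0}"
    and i0: "i0 \<in> I" and notin: "rat_char (wt i0) \<notin> cone_interior F"
  shows "\<exists>w. (\<forall>i\<in>I. 0 \<le> qdot r w (rat_char (wt i))) \<and> qdot r w (rat_char (wt i0)) = 0 \<and>
    (\<exists>k\<in>I. 0 < qdot r w (rat_char (wt k)))"
proof (rule ccontr)
  assume no: "\<not> ?thesis"
  define v where "v i = rat_char (wt i)" for i
  have vq: "v i \<in> qspace r" for i unfolding v_def by (rule rat_char_in_qspace[OF lat])
  have F_iff: "x \<in> F \<longleftrightarrow> (\<exists>q. (\<forall>i\<in>I. 0 \<le> q i) \<and> (\<forall>j. x j = (\<Sum>i\<in>I. q i * v i j)))" for x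
    using cone_face_iff_supported[of r u wt x, OF u] unfolding F I v_def by simp
  have ex: "\<exists>q n. (\<forall>i\<in>I. 0 \<le> q i) \<and> 0 \<le> n \<and> (\<forall>j. - v k j = (\<Sum>i\<in>I. q i * v i j) - n * v i0 j)"
    if k: "k \<in> I" for k
  proof (rule ccontr)
    assume no_comb: "\<not> ?thesis"
    \<comment> \<open>\<open>None\<close> labels the additional generator, the negative of
      \<open>v i0\<close>.\<close>
    define A where "A = insert None (Some ` I)"
    define v' where "v' p = (case p of None \<Rightarrow> (\<lambda>j. - v i0 j) | Some i \<Rightarrow> v i)" for p
    have "\<nexists>q. (\<forall>p\<in>A. 0 \<le> q p) \<and> (\<forall>j. - v k j = (\<Sum>p\<in>A. q p * v' p j))"
    proof
      assume "\<exists>q. (\<forall>p\<in>A. 0 \<le> q p) \<and> (\<forall>j. - v k j = (\<Sum>p\<in>A. q p * v' p j))"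
      then obtain q where q: "\<forall>p\<in>A. 0 \<le> q p" "\<forall>j. - v k j = (\<Sum>p\<in>A. q p * v' p j)" by blast
      have "(\<Sum>p\<in>A. q p * v' p j) = (\<Sum>i\<in>I. q (Some i) * v i j) - q None * v i0 j" for j
        by (simp add: A_def v'_def sum.reindex)
      hence "(\<forall>i\<in>I. 0 \<le> q (Some i)) \<and> 0 \<le> q None \<and>
          (\<forall>j. - v k j = (\<Sum>i\<in>I. q (Some i) * v i j) - q None * v i0 j)"
        using q by (auto simp: A_def)
      hence "\<exists>q n. (\<forall>i\<in>I. 0 \<le> q i) \<and> 0 \<le> n \<and> (\<forall>j. - v k j = (\<Sum>i\<in>I. q i * v i j) - n * v i0 j)"
        by (rule exI[of _ "\<lambda>i. q (Some i)", OF exI[of _ "q None"]])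
      thus False using no_comb by simp
    qed
    moreover have "v' p \<in> qspace r" for p
      using vq by (auto simp: v'_def qspace_def split: option.split)
    moreover have "(\<lambda>j. - v k j) \<in> qspace r" using vq[of k] by (simp add: qspace_def)
    ultimately obtain w where w: "\<forall>p\<in>A. 0 \<le> qdot r w (v' p)" "qdot r w (\<lambda>j. - v k j) < 0"
      using farkas[of A v' r "\<lambda>j. - v k j"] by (auto simp: A_def)
    have wI: "0 \<le> qdot r w (v i)" if "i \<in> I" for i
      using w(1)[rule_format, of "Some i"] that by (simp add: A_def v'_def)
    have "qdot r w (v i0) \<le> 0"
      using w(1)[rule_format, of None] by (simp add: A_def v'_def qdot_uminus)
    hence "qdot r w (v i0) = 0" using wI[OF i0] by simp
    moreover have "0 < qdot r w (v k)" using w(2) by (simp add: qdot_uminus)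
    ultimately show False using no wI k unfolding v_def by blast
  qed
  then obtain Q N where QN: "\<And>k i. k \<in> I \<Longrightarrow> i \<in> I \<Longrightarrow> 0 \<le> Q k i" "\<And>k. k \<in> I \<Longrightarrow> 0 \<le> N k"
    "\<And>k j. k \<in> I \<Longrightarrow> - v k j = (\<Sum>i\<in>I. Q k i * v i j) - N k * v i0 j"
    by metis
  obtain C where C: "C \<ge> 0" "\<And>e c. e \<ge> 0 \<Longrightarrow> \<forall>j. \<bar>\<Sum>i\<in>I. c i * v i j\<bar> \<le> e \<Longrightarrow>
    \<exists>d. (\<forall>j. (\<Sum>i\<in>I. d i * v i j) = (\<Sum>i\<in>I. c i * v i j)) \<and> (\<forall>i\<in>I. \<bar>d i\<bar> \<le> C * e)"
    using bounded_coefficients[of I v r] vq by auto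
  define S where "S = (\<Sum>k\<in>I. N k)"
  have S: "0 \<le> S" unfolding S_def by (rule sum_nonneg) (rule QN(2))
  \<comment> \<open>Coefficients of size at most \<open>C * e\<close> will then use up at most one
    copy of \<open>v i0\<close>; the 1 keeps the denominator positive.\<close>
  define e where "e = 1 / (1 + C * S)"
  have CS: "0 \<le> C * S" using C(1) S by simp
  hence e: "e > 0" "C * e * S \<le> 1" by (simp_all add: e_def field_simps)
  have "v i0 \<in> F"
    unfolding F_iff
    by (rule exI[of _ "\<lambda>k. if k = i0 then 1 else 0"])
      (use i0 in \<open>auto simp: if_distrib[of "\<lambda>x. x * _"] cong: if_cong\<close>)
  moreover have "y \<in> F" if y: "y \<in> qvec.span F" "\<forall>j. \<bar>y j - v i0 j\<bar> < e" for y
  proof -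
    define L where "L = {x. \<exists>c. \<forall>j. x j = (\<Sum>i\<in>I. c i * v i j)}"
    have "qvec.subspace L"
    proof (rule qvec.subspaceI)
      show "0 \<in> L" unfolding L_def by (auto intro!: exI[of _ "\<lambda>i. 0"])
    next
      fix x x' assume "x \<in> L" "x' \<in> L"
      then obtain c c' where "\<forall>j. x j = (\<Sum>i\<in>I. c i * v i j)" "\<forall>j. x' j = (\<Sum>i\<in>I. c' i * v i j)"
        unfolding L_def by blast
      hence "\<forall>j. (x + x') j = (\<Sum>i\<in>I. (c i + c' i) * v i j)"
        by (simp add: sum.distrib algebra_simps)
      thus "x + x' \<in> L" unfolding L_def by (intro CollectI exI[of _ "\<lambda>i. c i + c' i"])
    next
      fix t x assume "x \<in> L"
      then obtain c where "\<forall>j. x j = (\<Sum>i\<in>I. c i * v i j)" unfolding L_def by blast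
      hence "\<forall>j. qscale t x j = (\<Sum>i\<in>I. (t * c i) * v i j)"
        by (simp add: qscale_def sum_distrib_left algebra_simps)
      thus "qscale t x \<in> L" unfolding L_def by (intro CollectI exI[of _ "\<lambda>i. t * c i"])
    qed
    moreover have "F \<subseteq> L" using F_iff unfolding L_def by blast
    ultimately have "y \<in> L" using qvec.span_minimal y(1) by blast
    then obtain c where c: "\<And>j. y j = (\<Sum>i\<in>I. c i * v i j)" unfolding L_def by blast
    define c' where "c' k = c k - (if k = i0 then 1 else 0)" for k
    have c': "(\<Sum>i\<in>I. c' i * v i j) = y j - v i0 j" for j
      using i0 by (simp add: c'_def c left_diff_distrib sum_subtractf if_distrib[of "\<lambda>x. x * _"] cong: if_cong)
    have "\<forall>j. \<bar>\<Sum>i\<in>I. c' i * v i j\<bar> \<le> e"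
      unfolding c' using y(2) by (auto intro: less_imp_le)
    then obtain d where d: "\<And>j. (\<Sum>i\<in>I. d i * v i j) = y j - v i0 j" "\<And>i. i \<in> I \<Longrightarrow> \<bar>d i\<bar> \<le> C * e"
      using C(2)[of e c'] e(1) unfolding c' by auto
    \<comment> \<open>In \<open>y\<close>, written as \<open>v i0\<close> plus small multiples
      \<open>d k\<close> of the \<open>v k\<close>, the negative part \<open>n k\<close> is carried
      by \<open>- v k\<close>, which \<open>QN\<close> expresses through the generators at the cost
      of \<open>N k\<close> copies of \<open>v i0\<close>; the coefficients \<open>p\<close> below
      collect the result.\<close>
    define n where "n k = max 0 (- d k)" for k
    have n: "0 \<le> n k" "n k \<le> \<bar>d k\<bar>" "0 \<le> d k + n k" for k by (auto simp: n_def)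
    have nN: "(\<Sum>k\<in>I. n k * N k) \<le> 1"
    proof -
      have "(\<Sum>k\<in>I. n k * N k) \<le> (\<Sum>k\<in>I. C * e * N k)"
        by (intro sum_mono mult_right_mono order_trans[OF n(2) d(2)] QN(2))
      also have "\<dots> = C * e * S" by (simp add: S_def sum_distrib_left)
      finally show ?thesis using e(2) by simp
    qed
    define p where "p i = (if i = i0 then 1 - (\<Sum>k\<in>I. n k * N k) else 0) + (d i + n i) + (\<Sum>k\<in>I. n k * Q k i)" for i
    have "0 \<le> p i" if "i \<in> I" for i
      unfolding p_def by (intro add_nonneg_nonneg sum_nonneg mult_nonneg_nonneg n QN(1) that) (use nN in auto)
    moreover have "y j = (\<Sum>i\<in>I. p i * v i j)" for j
    proof -
      have "(\<Sum>i\<in>I. (\<Sum>k\<in>I. n k * Q k i) * v i j) = (\<Sum>k\<in>I. n k * (\<Sum>i\<in>I. Q k i * v i j))"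
        unfolding sum_distrib_left sum_distrib_right by (subst sum.swap) (simp add: mult_ac)
      also have "\<dots> = (\<Sum>k\<in>I. n k * (N k * v i0 j - v k j))"
        by (rule sum.cong) (use QN(3) in \<open>auto simp: algebra_simps\<close>)
      also have "\<dots> = (\<Sum>k\<in>I. n k * N k) * v i0 j - (\<Sum>k\<in>I. n k * v k j)"
        by (simp add: sum_subtractf sum_distrib_left algebra_simps)
      finally have 1: "(\<Sum>i\<in>I. (\<Sum>k\<in>I. n k * Q k i) * v i j) = \<dots>" .
      have 2: "(\<Sum>i\<in>I. (if i = i0 then t else 0) * v i j) = t * v i0 j" for t
        using i0 by (simp add: if_distrib[of "\<lambda>x. x * _"] cong: if_cong)
      have "(\<Sum>i\<in>I. p i * v i j) = (1 - (\<Sum>k\<in>I. n k * N k)) * v i0 j + ((\<Sum>i\<in>I. d i * v i j) + (\<Sum>k\<in>I. n k * v k j))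
          + ((\<Sum>k\<in>I. n k * N k) * v i0 j - (\<Sum>k\<in>I. n k * v k j))"
        unfolding p_def distrib_right sum.distrib 1 2 ..
      thus ?thesis unfolding d(1) by (simp add: algebra_simps)
    qed
    ultimately show "y \<in> F" unfolding F_iff by blast
  qed
  ultimately have "v i0 \<in> cone_interior F"
    unfolding cone_interior_def using e(1) by blast
  thus False using notin by (simp add: v_def)
qed

section \<open>Proportionality of coefficients\<close>

text \<open>Take \<open>z\<close> to be the one character interior to the face, if any. Every other
  character of the face has a supporting functional inside the face; adding a large multiple of
  \<open>u\<close> makes it positive on the generators off the face, and clearing denominators makes
  it integral.\<close>

lemma smaller_faces_if_few_interior:
  fixes wt :: "'n::finite \<Rightarrow> nat \<Rightarrow> int"
  assumes lat: "\<And>i. wt i \<in> char_lattice r"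
    and few: "\<And>F. cone_face r F (weight_cone wt) \<Longrightarrow> card {i. rat_char (wt i) \<in> cone_interior F} \<le> 1"
    and u: "\<And>i. 0 \<le> pairing r u (wt i)"
  shows "\<exists>z. \<forall>i. pairing r u (wt i) = 0 \<longrightarrow> i \<noteq> z \<longrightarrow>
    (\<exists>w. (\<forall>k. 0 \<le> pairing r w (wt k)) \<and> pairing r w (wt i) = 0 \<and>
      {k. pairing r w (wt k) = 0} \<subset> {k. pairing r u (wt k) = 0})"
proof -
  define v where "v i = rat_char (wt i)" for i
  define uq :: "nat \<Rightarrow> rat" where "uq = (\<lambda>j. of_int (u j))"
  have uv: "qdot r uq (v i) = of_int (pairing r u (wt i))" for i
    by (simp add: uq_def v_def qdot_rat_char)
  define F where "F = {x \<in> weight_cone wt. qdot r uq x = 0}"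
  define J where "J = {i. v i \<in> cone_interior F}"
  have "0 \<le> qdot r uq x" if x: "x \<in> weight_cone wt" for x
  proof -
    obtain q where q: "\<And>i. 0 \<le> q i" "\<And>j. x j = (\<Sum>i\<in>UNIV. q i * v i j)"
      using x by (auto simp: weight_cone_iff v_def)
    show ?thesis unfolding qdot_sum[OF q(2)]
      by (intro sum_nonneg mult_nonneg_nonneg q(1)) (simp add: uv u)
  qed
  hence "cone_face r F (weight_cone wt)"
    unfolding cone_face_def F_def qdot_def by blast
  hence "card J \<le> Suc 0" using few by (simp add: J_def v_def)
  hence "\<forall>i\<in>J. \<forall>j\<in>J. i = j" by (subst (asm) card_le_Suc0_iff_eq) auto
  then obtain z where z: "J \<subseteq> {z}" by (cases "J = {}") auto
  show ?thesis
  proof (intro exI[of _ z] allI impI)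
    fix i assume i: "pairing r u (wt i) = 0" "i \<noteq> z"
    define I where "I = {k. qdot r uq (v k) = 0}"
    have I: "k \<in> I \<longleftrightarrow> pairing r u (wt k) = 0" for k by (simp add: I_def uv)
    have "v i \<notin> cone_interior F" using z i by (auto simp: J_def)
    then obtain w where w: "\<And>k. k \<in> I \<Longrightarrow> 0 \<le> qdot r w (v k)" "qdot r w (v i) = 0"
      "\<exists>k\<in>I. 0 < qdot r w (v k)"
      using supporting_functional_if_not_interior[of wt r uq I F i] lat u i(1)
      unfolding I_def F_def v_def[symmetric] by (auto simp: uv)
    \<comment> \<open>Off the face the integer \<open>pairing r u (wt k)\<close> is at least 1, so
      \<open>N\<close> outweighs every value of \<open>w\<close>.\<close>
    define N where "N = 1 + (\<Sum>k\<in>UNIV. \<bar>qdot r w (v k)\<bar>)"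
    define W where "W = (\<lambda>j. 1 * w j + N * uq j)"
    have W: "qdot r W (v k) = qdot r w (v k) + N * of_int (pairing r u (wt k))" for k
      unfolding W_def qdot_lincomb_left by (simp add: uv)
    have W_in: "qdot r W (v k) = qdot r w (v k)" if "k \<in> I" for k using that by (simp add: W I)
    have W_out: "0 < qdot r W (v k)" if "k \<notin> I" for k
    proof -
      have "1 \<le> pairing r u (wt k)" using u[of k] that by (simp add: I)
      moreover have "0 \<le> N" by (simp add: N_def sum_nonneg add_nonneg_nonneg)
      ultimately have "N * 1 \<le> N * of_int (pairing r u (wt k))"
        by (intro mult_left_mono) simp_all
      moreover have "\<bar>qdot r w (v k)\<bar> \<le> (\<Sum>k\<in>UNIV. \<bar>qdot r w (v k)\<bar>)"
        by (rule member_le_sum) auto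
      hence "\<bar>qdot r w (v k)\<bar> + 1 \<le> N" by (simp add: N_def)
      ultimately show ?thesis unfolding W by linarith
    qed
    obtain D g where D: "D > 0" "\<And>j. j < r \<Longrightarrow> of_int D * W j = of_int (g j)"
      using common_denominator[of "{..<r}" W] by auto
    have g: "of_int (pairing r g (wt k)) = of_int D * qdot r W (v k)" for k
      unfolding qdot_rat_char[symmetric] v_def[symmetric] qdot_def sum_distrib_left
      by (rule sum.cong) (auto simp: D(2)[symmetric])
    have g0: "pairing r g (wt k) = 0 \<longleftrightarrow> qdot r W (v k) = 0" for k
      using g[of k] D(1) by (metis mult_eq_0_iff of_int_0 of_int_eq_iff less_irrefl)
    have "0 \<le> pairing r g (wt k)" for k
    proof -
      have "0 \<le> qdot r W (v k)" using W_in[of k] W_out[of k] w(1)[of k] by (cases "k \<in> I") auto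
      hence "(0::rat) \<le> of_int (pairing r g (wt k))" unfolding g using D(1) by simp
      thus ?thesis by simp
    qed
    moreover have "pairing r g (wt i) = 0" using W_in[of i] w(2) i(1) by (simp add: g0 I)
    moreover have "{k. pairing r g (wt k) = 0} \<subset> {k. pairing r u (wt k) = 0}"
    proof
      show "{k. pairing r g (wt k) = 0} \<subseteq> {k. pairing r u (wt k) = 0}"
        using W_out by (force simp: g0 I)
      obtain k where "k \<in> I" "0 < qdot r w (v k)" using w(3) by blast
      hence "pairing r u (wt k) = 0" "pairing r g (wt k) \<noteq> 0" using W_in[of k] by (auto simp: g0 I)
      thus "{k. pairing r g (wt k) = 0} \<noteq> {k. pairing r u (wt k) = 0}" by blast
    qed
    ultimately show "\<exists>w. (\<forall>k. 0 \<le> pairing r w (wt k)) \<and> pairing r w (wt i) = 0 \<and>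
        {k. pairing r w (wt k) = 0} \<subset> {k. pairing r u (wt k) = 0}" by blast
  qed
qed

text \<open>Characters on the same ray lie on the same faces. On a smallest face containing them,
  one of the two differs from the exceptional index and so lies on a smaller face, which then
  contains both.\<close>

lemma rays_distinct_if_few_interior:
  fixes wt :: "'n::finite \<Rightarrow> nat \<Rightarrow> int"
  assumes lat: "\<And>i. wt i \<in> char_lattice r"
    and few: "\<And>F. cone_face r F (weight_cone wt) \<Longrightarrow> card {i. rat_char (wt i) \<in> cone_interior F} \<le> 1"
    and "i \<noteq> j"
  shows "{qscale q (rat_char (wt i)) | q. 0 \<le> q} \<noteq> {qscale q (rat_char (wt j)) | q. 0 \<le> q}"
proof
  assume eq: "{qscale q (rat_char (wt i)) | q. 0 \<le> q} = {qscale q (rat_char (wt j)) | q. 0 \<le> q}"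
  have zero: "pairing r w (wt k) = 0"
    if rays: "{qscale q (rat_char (wt k)) | q. 0 \<le> q} = {qscale q (rat_char (wt l)) | q. 0 \<le> q}"
      and "pairing r w (wt l) = 0" for k l w
  proof -
    have "rat_char (wt k) = qscale 1 (rat_char (wt k))" by (simp add: qscale_def)
    hence "rat_char (wt k) \<in> {qscale q (rat_char (wt k)) | q. 0 \<le> q}" using zero_le_one by blast
    then obtain q where "rat_char (wt k) = qscale q (rat_char (wt l))" unfolding rays by blast
    hence "rat_char (wt k) j = q * rat_char (wt l) j" for j by (simp add: qscale_def)
    hence "(of_int (pairing r w (wt k)) :: rat) = (\<Sum>j<r. q * (of_int (w j) * rat_char (wt l) j))"
      unfolding qdot_rat_char[symmetric] qdot_def by (simp add: mult_ac)
    also have "\<dots> = q * of_int (pairing r w (wt l))"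
      by (simp add: qdot_rat_char[symmetric] qdot_def sum_distrib_left)
    finally show ?thesis using that(2) by simp
  qed
  have iff: "pairing r w (wt i) = 0 \<longleftrightarrow> pairing r w (wt j) = 0" for w
    using zero[OF eq, of w] zero[OF eq[symmetric], of w] by blast
  let ?P = "\<lambda>u. (\<forall>k. 0 \<le> pairing r u (wt k)) \<and> pairing r u (wt i) = 0"
  have "?P (\<lambda>_. 0)" by (simp add: pairing_def)
  then obtain u where u: "?P u"
    and min: "\<And>w. ?P w \<Longrightarrow> card {k. pairing r u (wt k) = 0} \<le> card {k. pairing r w (wt k) = 0}"
    using ex_has_least_nat[of ?P _ "\<lambda>u. card {k. pairing r u (wt k) = 0}"] by blast
  obtain z where z: "\<And>l. pairing r u (wt l) = 0 \<Longrightarrow> l \<noteq> z \<Longrightarrow>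
    \<exists>w. (\<forall>k. 0 \<le> pairing r w (wt k)) \<and> pairing r w (wt l) = 0 \<and>
      {k. pairing r w (wt k) = 0} \<subset> {k. pairing r u (wt k) = 0}"
    using smaller_faces_if_few_interior[of wt r u, OF lat few] u by blast
  define l where "l = (if i = z then j else i)"
  have l: "l \<noteq> z" "pairing r u (wt l) = 0" "\<And>w. pairing r w (wt l) = 0 \<longleftrightarrow> pairing r w (wt i) = 0"
    using \<open>i \<noteq> j\<close> u iff by (auto simp: l_def)
  obtain w where w: "\<forall>k. 0 \<le> pairing r w (wt k)" "pairing r w (wt l) = 0"
    "{k. pairing r w (wt k) = 0} \<subset> {k. pairing r u (wt k) = 0}"
    using z[OF l(2,1)] by blast
  have "card {k. pairing r w (wt k) = 0} < card {k. pairing r u (wt k) = 0}"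
    by (rule psubset_card_mono) (use w in auto)
  thus False using min[of w] w l(3) by force
qed

text \<open>Otherwise proportionality kills all of \<open>a\<close> on \<open>A\<close>, so its
  Laurent polynomial vanishes on the whole torus, while that of \<open>b\<close> does not.\<close>

lemma zero_coeff_if_proportional:
  fixes a b :: "'n \<Rightarrow> 'k::alg_closed_field"
  assumes "finite A" "inj_on wt A" "\<And>i. i \<in> A \<Longrightarrow> wt i \<in> char_lattice r"
    and eq: "same_zeros r wt a b A"
    and pr: "\<And>k. k \<in> A \<Longrightarrow> a k * b i = a i * b k"
    and i: "i \<in> A" "a i = 0"
  shows "b i = 0"
proof (rule ccontr)
  assume "b i \<noteq> 0"
  hence "a k = 0" if "k \<in> A" for k using pr[OF that] i by simp
  hence "char_sum r wt a A s = 0" for s by (simp add: char_sum_def)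
  moreover obtain s where "s \<in> torus r" "char_sum r wt b A s \<noteq> 0"
    using char_sum_not_identically_0[of A wt r i b] assms \<open>b i \<noteq> 0\<close> by blast
  ultimately show False using eq by (simp add: same_zeros_def)
qed

text \<open>Induction on the number of characters on a face; the cone itself is the face of
  \<open>u = 0\<close>.\<close>

lemma coefficients_proportional:
  fixes a b :: "'n::finite \<Rightarrow> 'k::alg_closed_field"
  assumes lat: "\<And>i. wt i \<in> char_lattice r"
    and few: "\<And>F. cone_face r F (weight_cone wt) \<Longrightarrow> card {i. rat_char (wt i) \<in> cone_interior F} \<le> 1"
    and eq: "\<And>u. (\<forall>i. 0 \<le> pairing r u (wt i)) \<Longrightarrow> same_zeros r wt a b {i. pairing r u (wt i) = 0}"
  shows "a i * b j = a j * b i"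
proof -
  have inj: "inj wt"
  proof (rule injI, rule ccontr)
    fix i j assume "wt i = wt j" "i \<noteq> j"
    thus False using rays_distinct_if_few_interior[OF lat few, of i j] by simp
  qed
  hence inj_on: "inj_on wt A" for A by (rule inj_on_subset) simp
  have "\<forall>i j. pairing r u (wt i) = 0 \<longrightarrow> pairing r u (wt j) = 0 \<longrightarrow> a i * b j = a j * b i"
    if "\<forall>i. 0 \<le> pairing r u (wt i)" for u
    using that
  proof (induction "card {i. pairing r u (wt i) = 0}" arbitrary: u rule: less_induct)
    case less
    define I where "I = {i. pairing r u (wt i) = 0}"
    obtain z where z: "\<And>i. i \<in> I \<Longrightarrow> i \<noteq> z \<Longrightarrow>
      \<exists>w. (\<forall>k. 0 \<le> pairing r w (wt k)) \<and> pairing r w (wt i) = 0 \<and> {k. pairing r w (wt k) = 0} \<subset> I"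
      using smaller_faces_if_few_interior[of wt r u, OF lat few] less.prems unfolding I_def by blast
    have face: "\<exists>w. (\<forall>k. 0 \<le> pairing r w (wt k)) \<and> pairing r w (wt i) = 0 \<and>
        (\<forall>k l. pairing r w (wt k) = 0 \<longrightarrow> pairing r w (wt l) = 0 \<longrightarrow> a k * b l = a l * b k)"
      if i: "i \<in> I" "i \<noteq> z" for i
    proof -
      obtain w where w: "\<forall>k. 0 \<le> pairing r w (wt k)" "pairing r w (wt i) = 0"
        "{k. pairing r w (wt k) = 0} \<subset> I"
        using z[OF i] by blast
      have "card {k. pairing r w (wt k) = 0} < card I" by (rule psubset_card_mono) (use w in auto)
      from less.hyps[OF this[unfolded I_def] w(1)] w(1,2) show ?thesis by blast
    qed
    \<comment> \<open>An index other than \<open>z\<close> lies on a smaller face, where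
      proportionality is known, so a zero of one coefficient forces a zero of the other.\<close>
    have supp: "a i = 0 \<longleftrightarrow> b i = 0" if i: "i \<in> I" "i \<noteq> z" for i
    proof -
      obtain w where w: "\<forall>k. 0 \<le> pairing r w (wt k)" "pairing r w (wt i) = 0"
        and pr: "\<And>k l. pairing r w (wt k) = 0 \<Longrightarrow> pairing r w (wt l) = 0 \<Longrightarrow> a k * b l = a l * b k"
        using face[OF i] by blast
      let ?A = "{k. pairing r w (wt k) = 0}"
      have pa: "a k * b i = a i * b k" and pb: "b k * a i = b i * a k" if "k \<in> ?A" for k
        using pr[of k i] that w(2) by (simp_all add: mult.commute)
      have mem: "i \<in> ?A" using w(2) by simp
      have "b i = 0" if "a i = 0"
        by (rule zero_coeff_if_proportional[OF finite inj_on lat eq[OF w(1)] pa mem that])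
      moreover have "a i = 0" if "b i = 0"
        by (rule zero_coeff_if_proportional[OF finite inj_on lat same_zeros_sym[OF eq[OF w(1)]] pb mem that])
      ultimately show ?thesis by blast
    qed
    \<comment> \<open>Dropping the indices where both coefficients vanish leaves the sums unchanged
      and makes the ratios meaningful, except possibly at \<open>z\<close>.\<close>
    define S where "S = {k \<in> I. a k \<noteq> 0 \<or> b k \<noteq> 0}"
    have zerosS: "same_zeros r wt a b S"
    proof -
      have "char_sum r wt c I s = char_sum r wt c S s" if "c = a \<or> c = b" for c s
        by (rule char_sum_mono_neutral) (use that in \<open>auto simp: S_def\<close>)
      thus ?thesis using eq[OF less.prems] unfolding same_zeros_def I_def[symmetric] by simp
    qed
    have ratio: "a i / b i = a j / b j" if ij: "i \<in> S" "j \<in> S" for i j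
    proof (rule coeff_ratio_constant[of S wt r z a b])
      fix i assume i: "i \<in> S" "i \<noteq> z"
      show nz: "a i \<noteq> 0 \<and> b i \<noteq> 0" using supp[of i] i by (auto simp: S_def)
      obtain w where w: "\<forall>k. 0 \<le> pairing r w (wt k)" "pairing r w (wt i) = 0"
        and pr: "\<And>k l. pairing r w (wt k) = 0 \<Longrightarrow> pairing r w (wt l) = 0 \<Longrightarrow> a k * b l = a l * b k"
        using face[of i] i by (auto simp: S_def)
      have "a k / b k = a i / b i" if "k \<in> S" "pairing r w (wt k) = 0" for k
      proof -
        have *: "a k * b i = a i * b k" using pr that(2) w(2) by blast
        hence "b k \<noteq> 0" using nz that(1) by (auto simp: S_def)
        thus ?thesis using * nz by (simp add: field_simps)
      qed
      thus "\<exists>w. (\<forall>k\<in>S. 0 \<le> pairing r w (wt k)) \<and> pairing r w (wt i) = 0 \<and>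
          (\<forall>k\<in>S. \<forall>l\<in>S. pairing r w (wt k) = 0 \<longrightarrow> pairing r w (wt l) = 0 \<longrightarrow> a k / b k = a l / b l)"
        using w by (intro exI[of _ w]) simp
    qed (use ij inj_on lat zerosS in \<open>auto simp: S_def\<close>)
    have "a i * b j = a j * b i" if ij: "i \<in> I" "j \<in> I" for i j
    proof (cases "i \<in> S \<and> j \<in> S \<and> i \<noteq> j")
      case False
      thus ?thesis using ij by (auto simp: S_def)
    next
      case True
      \<comment> \<open>One of the two indices is not \<open>z\<close> and has a non-zero ratio, so
        the common ratio is non-zero; since division by 0 yields 0, both denominators are
        non-zero.\<close>
      hence "a i / b i = a j / b j" using ratio by blast
      thus ?thesis using True supp[of i] supp[of j] ij
        by (cases "b i = 0"; cases "b j = 0"; cases "i = z"; cases "j = z") (auto simp: S_def field_simps)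
    qed
    thus ?case by (auto simp: I_def)
  qed
  from this[of "\<lambda>_. 0"] show ?thesis by (simp add: pairing_def)
qed

section \<open>The orbit closure and hyperplanes\<close>

lemma in_zariski_hullI:
  assumes "\<And>p. (\<And>y. y \<in> S \<Longrightarrow> poly_eval p y = 0) \<Longrightarrow> poly_eval p x = 0"
  shows "x \<in> zariski_closed hull S"
proof -
  have "x \<in> Z" if Z: "zariski_closed Z" "S \<subseteq> Z" for Z
  proof -
    obtain P where "Z = {x. \<forall>p\<in>P. poly_eval p x = 0}" using Z(1) by (auto simp: zariski_closed_def)
    thus ?thesis using Z(2) assms by auto
  qed
  thus ?thesis by (auto simp: hull_def)
qed

lemma poly_eval_zero_on_zariski_hull:
  assumes "x \<in> zariski_closed hull S" "\<And>y. y \<in> S \<Longrightarrow> poly_eval p y = 0"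
  shows "poly_eval p x = 0"
proof -
  have "zariski_closed hull S \<subseteq> {x. poly_eval p x = 0}"
    by (rule hull_minimal) (use assms(2) in \<open>auto simp: zariski_closed_def intro!: exI[of _ "{p}"]\<close>)
  thus ?thesis using assms(1) by blast
qed

lemma orbit_eq:
  "(\<lambda>t. torus_act r wt t (\<chi> i. 1)) ` torus r = {(\<chi> i. char_eval r (wt i) t) | t. t \<in> torus r}"
  by (auto simp: torus_act_def)

text \<open>This point is the limit at \<open>0\<close> of the curve obtained by moving the orbit point of \<open>s\<close> along the
  one-parameter subgroup \<open>u\<close>.\<close>

lemma face_point_in_orbit_closure:
  fixes wt :: "'n::finite \<Rightarrow> nat \<Rightarrow> int" and s :: "nat \<Rightarrow> 'k::alg_closed_field"
  assumes u: "\<And>i. 0 \<le> pairing r u (wt i)" and s: "s \<in> torus r"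
  shows "(\<chi> i. if pairing r u (wt i) = 0 then char_eval r (wt i) s else 0) \<in> orbit_closure r wt"
  unfolding orbit_closure_def orbit_eq
proof (rule in_zariski_hullI)
  fix p :: "('n \<Rightarrow>\<^sub>0 nat) \<Rightarrow>\<^sub>0 'k"
  assume zero: "\<And>y. y \<in> {(\<chi> i. char_eval r (wt i) t) | t. t \<in> torus r} \<Longrightarrow> poly_eval p y = 0"
  \<comment> \<open>This is \<open>p\<close> along the curve, as a polynomial in \<open>x\<close>;
    it vanishes for \<open>x\<close> other than 0, hence also at 0, where \<open>0 ^ 0 = 1\<close>
    keeps exactly the coordinates on the face.\<close>
  define q where "q = (\<Sum>m\<in>Poly_Mapping.keys p. smult (Poly_Mapping.lookup p m)
    (\<Prod>i\<in>UNIV. monom (char_eval r (wt i) s) (nat (pairing r u (wt i))) ^ Poly_Mapping.lookup m i))"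
  have q: "poly q x = poly_eval p (\<chi> i. char_eval r (wt i) s * x ^ nat (pairing r u (wt i)))" for x
    by (simp add: q_def poly_eval_def poly_sum poly_prod poly_monom)
  have "poly q x = 0" if x: "poly [:0, 1:] x \<noteq> 0" for x
  proof -
    have x0: "x \<noteq> 0" using x by simp
    have "(\<chi> i. char_eval r (wt i) s * x ^ nat (pairing r u (wt i))) = (\<chi> i. char_eval r (wt i) (twist r u x s))"
      using u by (simp add: char_eval_twist[OF x0] power_int_def vec_eq_iff mult.commute)
    thus ?thesis unfolding q using zero twist_in_torus[OF x0 s] by auto
  qed
  moreover have "[:0, 1:] \<noteq> (0 :: 'k poly)" by (simp add: pCons_eq_0_iff)
  ultimately have "q = 0" using poly_eq_0_if_cofinite_roots by blast
  hence "poly_eval p (\<chi> i. char_eval r (wt i) s * 0 ^ nat (pairing r u (wt i))) = 0"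
    using q[of 0] by simp
  moreover have "char_eval r (wt i) s * 0 ^ nat (pairing r u (wt i)) =
      (if pairing r u (wt i) = 0 then char_eval r (wt i) s else 0)" for i
    using u[of i] by (auto simp: power_0_left)
  ultimately show "poly_eval p (\<chi> i. if pairing r u (wt i) = 0 then char_eval r (wt i) s else 0) = 0"
    by simp
qed

lemma prod_char_eval_power:
  assumes "t \<in> torus r"
  shows "(\<Prod>i\<in>A. char_eval r (wt i) t ^ p i) = (\<Prod>j<r. t j powi (\<Sum>i\<in>A. int (p i) * wt i j))"
proof -
  have "(\<Prod>i\<in>A. char_eval r (wt i) t ^ p i) = (\<Prod>i\<in>A. \<Prod>j<r. t j powi (int (p i) * wt i j))"
    by (simp add: char_eval_def power_int_mult mult.commute[of "int _"] flip: prod_power_distrib)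
  also have "\<dots> = (\<Prod>j<r. \<Prod>i\<in>A. t j powi (int (p i) * wt i j))" by (rule prod.swap)
  also have "\<dots> = (\<Prod>j<r. t j powi (\<Sum>i\<in>A. int (p i) * wt i j))"
    by (rule prod.cong) (use assms in \<open>auto simp: torus_def PiE_iff intro!: prod_powi\<close>)
  finally show ?thesis .
qed

text \<open>Both monomials restrict to the same character on the orbit, so their difference vanishes
  there and on the closure.\<close>

lemma monomial_relation_on_orbit_closure:
  fixes wt :: "'n::finite \<Rightarrow> nat \<Rightarrow> int" and x :: "'k::field ^ 'n"
  assumes rel: "\<And>j. (\<Sum>i\<in>UNIV. int (p i) * wt i j) = (\<Sum>i\<in>UNIV. int (q i) * wt i j)"
    and x: "x \<in> orbit_closure r wt"
  shows "(\<Prod>i\<in>UNIV. x $ i ^ p i) = (\<Prod>i\<in>UNIV. x $ i ^ q i)"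
proof (cases "p = q")
  case False
  define P Q where "P = Abs_poly_mapping p" and "Q = Abs_poly_mapping q"
  have lookup: "Poly_Mapping.lookup P = p" "Poly_Mapping.lookup Q = q"
    unfolding P_def Q_def by (rule lookup_Abs_poly_mapping; simp)+
  hence PQ: "P \<noteq> Q" using False by auto
  define f where "f = Poly_Mapping.single P (1::'k) - Poly_Mapping.single Q 1"
  have eval: "poly_eval f y = (\<Prod>i\<in>UNIV. y $ i ^ p i) - (\<Prod>i\<in>UNIV. y $ i ^ q i)" for y
  proof -
    have "Poly_Mapping.keys f \<subseteq> {P, Q}"
      unfolding f_def by (auto simp: in_keys_iff lookup_minus lookup_single when_def split: if_splits)
    hence "poly_eval f y = (\<Sum>m\<in>{P, Q}. Poly_Mapping.lookup f m * (\<Prod>i\<in>UNIV. (y $ i) ^ Poly_Mapping.lookup m i))"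
      unfolding poly_eval_def by (intro sum.mono_neutral_left) (auto simp: in_keys_iff)
    thus ?thesis using PQ by (simp add: f_def lookup_minus lookup_single lookup)
  qed
  have "poly_eval f x = 0"
    using x unfolding orbit_closure_def orbit_eq
    by (rule poly_eval_zero_on_zariski_hull) (auto simp: eval prod_char_eval_power rel)
  thus ?thesis by (simp add: eval)
qed simp

text \<open>After clearing denominators, the terms with negative coefficients go to the other side
  of a monomial relation; a zero factor on one side forces one on the other. Without negative
  coefficients the other side is 1, which excludes such a zero.\<close>

lemma coordinate_zero_from_relation:
  fixes wt :: "'n::finite \<Rightarrow> nat \<Rightarrow> int" and x :: "'k::field ^ 'n" and c :: "'n \<Rightarrow> rat"
  assumes rel: "\<And>j. (\<Sum>i\<in>UNIV. c i * rat_char (wt i) j) = 0"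
    and x: "x \<in> orbit_closure r wt" and i: "0 < c i" "x $ i = 0"
  shows "\<exists>k. c k < 0 \<and> x $ k = 0"
proof -
  obtain D g where D: "D > 0" "\<And>i. of_int D * c i = of_int (g i)"
    using common_denominator[of UNIV c] by auto
  have sgn: "0 < g i \<longleftrightarrow> 0 < c i" "g i < 0 \<longleftrightarrow> c i < 0" for i
  proof -
    have "(0::rat) < of_int (g i) \<longleftrightarrow> 0 < c i" "of_int (g i) < (0::rat) \<longleftrightarrow> c i < 0"
      unfolding D(2)[symmetric] using D(1) by (simp_all add: zero_less_mult_iff mult_less_0_iff)
    thus "0 < g i \<longleftrightarrow> 0 < c i" "g i < 0 \<longleftrightarrow> c i < 0" by simp_all
  qed
  have g: "(\<Sum>i\<in>UNIV. g i * wt i j) = 0" for j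
  proof -
    have "of_int (\<Sum>i\<in>UNIV. g i * wt i j) = of_int D * (\<Sum>i\<in>UNIV. c i * rat_char (wt i) j)"
      by (simp add: D(2)[symmetric] rat_char_def sum_distrib_left mult_ac)
    hence "(of_int (\<Sum>i\<in>UNIV. g i * wt i j) :: rat) = 0" by (simp add: rel)
    thus ?thesis by (simp only: of_int_eq_0_iff)
  qed
  have "(\<Sum>i\<in>UNIV. int (nat (g i)) * wt i j) = (\<Sum>i\<in>UNIV. int (nat (- g i)) * wt i j)" for j
  proof -
    have "int (nat (g i)) * wt i j - int (nat (- g i)) * wt i j = g i * wt i j" for i
      by (simp add: left_diff_distrib[symmetric])
    hence "(\<Sum>i\<in>UNIV. int (nat (g i)) * wt i j) - (\<Sum>i\<in>UNIV. int (nat (- g i)) * wt i j) = 0"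
      unfolding sum_subtractf[symmetric] by (simp only: g)
    thus ?thesis by simp
  qed
  hence "(\<Prod>i\<in>UNIV. x $ i ^ nat (g i)) = (\<Prod>i\<in>UNIV. x $ i ^ nat (- g i))"
    using x by (rule monomial_relation_on_orbit_closure)
  moreover have "(\<Prod>i\<in>UNIV. x $ i ^ nat (g i)) = 0"
    by (rule prod_zero) (use i sgn in \<open>auto intro!: bexI[of _ i]\<close>)
  ultimately obtain k where "x $ k ^ nat (- g k) = 0" by auto
  hence "x $ k = 0" "g k < 0" by (auto simp: power_eq_0_iff)
  thus ?thesis using sgn by blast
qed

lemma hyperplane_coordinate: "hyperplane {x :: 'k::field ^ 'n::finite. x $ i = 0}"
proof -
  have eq: "{x :: 'k ^ 'n. x $ i = 0} = {x. \<forall>k. k \<notin> UNIV - {i} \<longrightarrow> x $ k = 0}" by auto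
  have "vec.dim {x :: 'k ^ 'n. x $ i = 0} = CARD('n) - 1"
    unfolding eq dim_substandard_cart by (simp add: card_Diff_singleton)
  moreover have "vec.subspace {x :: 'k ^ 'n. x $ i = 0}"
    by (rule vec.subspaceI) auto
  moreover have "CARD('n) \<ge> 1" by (simp add: Suc_leI)
  ultimately show ?thesis by (simp add: hyperplane_def)
qed

lemma coordinate_hyperplanes_distinct:
  assumes "i \<noteq> j" shows "{x :: 'k::field ^ 'n. x $ i = 0} \<noteq> {x. x $ j = 0}"
proof -
  have "axis i (1::'k) \<in> {x. x $ j = 0}" "axis i (1::'k) \<notin> {x. x $ i = 0}"
    using assms by (simp_all add: axis_def)
  thus ?thesis by blast
qed

lemma not_weak_separation_if_coordinates_agree:
  fixes X :: "('k::field ^ 'n::finite) set"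
  assumes "i \<noteq> j" "\<And>x. x \<in> X \<Longrightarrow> x $ i = 0 \<longleftrightarrow> x $ j = 0"
  shows "\<not> weak_separation X"
proof -
  have "{x. x $ i = 0} \<inter> X = {x. x $ j = 0} \<inter> X" using assms(2) by blast
  thus ?thesis
    unfolding weak_separation_def
    using hyperplane_coordinate coordinate_hyperplanes_distinct[OF assms(1)] by blast
qed

text \<open>Extend a basis of \<open>H\<close> by a vector \<open>v\<close> outside and take a
  linear map that kills \<open>H\<close> but not \<open>v\<close>.\<close>

lemma hyperplane_eq_kernel:
  fixes H :: "('k::field ^ 'n::finite) set"
  assumes "hyperplane H"
  shows "\<exists>a. (\<exists>i. a i \<noteq> 0) \<and> H = {x. (\<Sum>i\<in>UNIV. a i * x $ i) = 0}"
proof -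
  have sub: "vec.subspace H" and dim: "vec.dim H + 1 = CARD('n)"
    using assms by (auto simp: hyperplane_def)
  obtain B where B: "B \<subseteq> H" "vec.independent B" "H \<subseteq> vec.span B" "card B = vec.dim H"
    using vec.basis_exists by blast
  have span: "vec.span B = H" using B sub by (metis subset_antisym vec.span_minimal)
  have dim_UNIV: "vec.dim (UNIV :: ('k ^ 'n) set) = CARD('n)"
    using dim_substandard_cart[of "UNIV :: 'n set", where 'a = 'k] by simp
  have "H \<noteq> UNIV" using dim dim_UNIV by auto
  then obtain v where v: "v \<notin> H" by blast
  have ind: "vec.independent (insert v B)"
    using B(2) v span by (simp add: vec.independent_insertI)
  have "finite B" using B(2) by (rule vec.finiteI_independent)
  hence "card (insert v B) = CARD('n)" using v B(1,4) dim by (subst card_insert_disjoint) auto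
  hence all: "vec.span (insert v B) = UNIV"
    using ind vec.card_ge_dim_independent[of "insert v B" UNIV] by (metis dim_UNIV finite.insertI order_refl subset_UNIV top.extremum_uniqueI)
  \<comment> \<open>The map takes values in the whole vector space, so an arbitrary coordinate
    \<open>i0\<close> is fixed to turn it into a functional.\<close>
  obtain i0 :: 'n where True by blast
  obtain g where g: "Vector_Spaces.linear (*s) (*s) g"
    "\<forall>x\<in>insert v B. g x = (if x = v then axis i0 1 else 0)"
    using vec.linear_independent_extend[OF ind, of "\<lambda>x. if x = v then axis i0 1 else 0"] by blast
  define a where "a j = matrix g $ i0 $ j" for j
  have a: "(\<Sum>j\<in>UNIV. a j * x $ j) = g x $ i0" for x
    using matrix_works[OF g(1), of x] by (simp add: a_def matrix_vector_mult_def vec_eq_iff)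
  have gH: "g x = 0" if "x \<in> H" for x
  proof -
    have "g b = 0" if "b \<in> B" for b using g(2) that v B(1) by auto
    thus ?thesis using vec.linear_eq_0_on_span[OF g(1)] \<open>x \<in> H\<close> span by blast
  qed
  have gv: "g v $ i0 = 1" using g(2) by (simp add: axis_def)
  have "x \<in> H" if "g x $ i0 = 0" for x
  proof -
    obtain c where c: "x - c *s v \<in> H"
      using all vec.span_breakdown_eq[of x v B] span by auto
    have "g x = g (x - c *s v) + c *s g v"
      using g(1) by (simp add: vec.linear_diff vec.linear_scale)
    hence "g x $ i0 = c" using gH[OF c] gv by simp
    thus ?thesis using c that by simp
  qed
  hence "H = {x. (\<Sum>i\<in>UNIV. a i * x $ i) = 0}" using gH by (auto simp: a)
  moreover have "\<exists>i. a i \<noteq> 0"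
  proof (rule ccontr)
    assume "\<not> ?thesis"
    hence "g v $ i0 = 0" by (simp add: a[symmetric])
    thus False using gv by simp
  qed
  ultimately show ?thesis by blast
qed

section \<open>Necessity of the two conditions\<close>

lemma direction_in_cone_if_line:
  fixes wt :: "'n::finite \<Rightarrow> nat \<Rightarrow> int"
  assumes lat: "\<And>i. wt i \<in> char_lattice r"
    and line: "\<And>c. x + qscale c v \<in> weight_cone wt"
  shows "v \<in> weight_cone wt"
proof (rule ccontr)
  assume "v \<notin> weight_cone wt"
  hence no: "\<nexists>q. (\<forall>i\<in>UNIV. 0 \<le> q i) \<and> (\<forall>j. v j = (\<Sum>i\<in>UNIV. q i * rat_char (wt i) j))"
    by (simp add: weight_cone_iff)
  have outside: "y j = 0" if y: "y \<in> weight_cone wt" and j: "r \<le> j" for y j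
  proof -
    obtain q where "\<And>j. y j = (\<Sum>i\<in>UNIV. q i * rat_char (wt i) j)"
      using y by (auto simp: weight_cone_iff)
    thus ?thesis using lat j by (simp add: rat_char_def char_lattice_def)
  qed
  have "v \<in> qspace r"
    using outside[OF line[of 0]] outside[OF line[of 1]] by (auto simp: qspace_def qscale_def)
  then obtain w where w: "\<And>i. 0 \<le> qdot r w (rat_char (wt i))" "qdot r w v < 0"
    using farkas[OF finite _ _ no] rat_char_in_qspace[OF lat] by blast
  \<comment> \<open>At this parameter the functional takes the value
    \<open>qdot r w x - \<bar>qdot r w x\<bar> - 1\<close>, which is negative although it is
    non-negative on the cone.\<close>
  define c where "c = (\<bar>qdot r w x\<bar> + 1) / - qdot r w v"
  obtain q where q: "\<And>i. 0 \<le> q i" "\<And>j. (x + qscale c v) j = (\<Sum>i\<in>UNIV. q i * rat_char (wt i) j)"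
    using line[of c] by (auto simp: weight_cone_iff)
  have "0 \<le> qdot r w (x + qscale c v)"
    unfolding qdot_sum[OF q(2)] by (intro sum_nonneg mult_nonneg_nonneg q(1) w(1))
  moreover have "qdot r w (x + qscale c v) = qdot r w x + c * qdot r w v"
    using qdot_lincomb[of r w 1 x c v] by (simp add: qscale_def plus_fun_def)
  moreover have "c * qdot r w v = - (\<bar>qdot r w x\<bar> + 1)" using w(2) by (simp add: c_def field_simps)
  ultimately show False by linarith
qed

text \<open>A line puts some \<open>v\<close> and \<open>- v\<close> in the cone; adding their
  representations gives a relation with non-negative coefficients, so coordinates with positive
  coefficient never vanish on the closure. Two of them give coordinate hyperplanes that both miss
  it.\<close>

lemma strictly_convex_if_weak_separation:
  fixes wt :: "'n::finite \<Rightarrow> nat \<Rightarrow> int"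
  assumes lat: "\<And>i. wt i \<in> char_lattice r"
    and ws: "weak_separation (orbit_closure r wt :: ('k::field ^ 'n) set)"
  shows "strictly_convex (weight_cone wt)"
proof (rule ccontr)
  assume "\<not> ?thesis"
  then obtain x v where v: "v \<noteq> 0" and line: "\<And>c. x + qscale c v \<in> weight_cone wt"
    by (auto simp: strictly_convex_def)
  have "v \<in> weight_cone wt" by (rule direction_in_cone_if_line[OF lat line])
  then obtain p where p: "\<And>i. 0 \<le> p i" "\<And>j. v j = (\<Sum>i\<in>UNIV. p i * rat_char (wt i) j)"
    by (auto simp: weight_cone_iff)
  have "x + qscale c (qscale (-1) v) \<in> weight_cone wt" for c
    using line[of "- c"] by (simp add: qscale_def)
  hence "qscale (-1) v \<in> weight_cone wt" by (rule direction_in_cone_if_line[OF lat])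
  then obtain q where q: "\<And>i. 0 \<le> q i" "\<And>j. - v j = (\<Sum>i\<in>UNIV. q i * rat_char (wt i) j)"
    by (auto simp: weight_cone_iff qscale_def)
  define c where "c i = p i + q i" for i
  have rel: "(\<Sum>i\<in>UNIV. c i * rat_char (wt i) j) = 0" for j
    using p(2)[of j] q(2)[of j] by (simp add: c_def distrib_right sum.distrib)
  have c: "0 \<le> c i" for i using p(1) q(1) by (simp add: c_def)
  have nonzero: "y $ i \<noteq> 0" if "0 < c i" "y \<in> orbit_closure r wt" for i and y :: "'k ^ 'n"
    using coordinate_zero_from_relation[OF rel that(2,1)] c by (metis not_le)
  obtain j where j: "v j \<noteq> 0" using v by (auto simp: fun_eq_iff)
  hence "\<exists>k. p k * rat_char (wt k) j \<noteq> 0" unfolding p(2) by (meson sum.neutral)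
  then obtain k where k: "p k * rat_char (wt k) j \<noteq> 0" by blast
  have ck: "0 < c k" using k p(1)[of k] q(1)[of k] by (auto simp: c_def less_le)
  \<comment> \<open>If only \<open>k\<close> had a positive coefficient, the relation would force
    entry \<open>j\<close> of its character to vanish, against the choice of
    \<open>k\<close>.\<close>
  have "\<exists>l. l \<noteq> k \<and> 0 < c l"
  proof (rule ccontr)
    assume "\<not> ?thesis"
    hence "c l = 0" if "l \<noteq> k" for l using that c[of l] by (auto simp: less_le)
    hence "(\<Sum>i\<in>UNIV. c i * rat_char (wt i) j) = (\<Sum>i\<in>{k}. c i * rat_char (wt i) j)"
      by (intro sum.mono_neutral_right) auto
    thus False using rel[of j] ck k by simp
  qed
  then obtain l where "l \<noteq> k" "0 < c l" by blast
  hence "\<not> weak_separation (orbit_closure r wt :: ('k ^ 'n) set)"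
    using nonzero ck by (intro not_weak_separation_if_coordinates_agree[of l k]) auto
  thus False using ws by simp
qed

text \<open>An interior character \<open>i\<close> minus a small multiple of another character
  \<open>j\<close> of the face stays in the face. In the resulting relation only \<open>i\<close>
  can have a negative coefficient, so \<open>y $ j = 0\<close> forces \<open>y $ i = 0\<close>; for
  two interior characters this holds both ways.\<close>

lemma few_interior_if_weak_separation:
  fixes wt :: "'n::finite \<Rightarrow> nat \<Rightarrow> int"
  assumes lat: "\<And>i. wt i \<in> char_lattice r"
    and ws: "weak_separation (orbit_closure r wt :: ('k::field ^ 'n) set)"
    and F: "cone_face r F (weight_cone wt)"
  shows "card {i. rat_char (wt i) \<in> cone_interior F} \<le> 1"
proof -
  have sub: "F \<subseteq> weight_cone wt" using F by (auto simp: cone_face_def)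
  have vanish: "y $ i = 0"
    if i: "rat_char (wt i) \<in> cone_interior F" and j: "rat_char (wt j) \<in> cone_interior F"
      and y: "y \<in> orbit_closure r wt" "y $ j = 0" and ne: "i \<noteq> j" for i j and y :: "'k ^ 'n"
  proof -
    obtain e where e: "e > 0"
      and near: "\<And>z. z \<in> qvec.span F \<Longrightarrow> (\<And>l. \<bar>z l - rat_char (wt i) l\<bar> < e) \<Longrightarrow> z \<in> F"
      using i by (auto simp: cone_interior_def)
    define B where "B = (\<Sum>l<r. \<bar>rat_char (wt j) l\<bar>)"
    define e' where "e' = e / (1 + B)"
    have B: "0 \<le> B" by (simp add: B_def sum_nonneg)
    have bound: "\<bar>rat_char (wt j) l\<bar> \<le> B" for l
    proof (cases "l < r")
      case True
      thus ?thesis unfolding B_def by (intro member_le_sum[of l _ "\<lambda>l. \<bar>rat_char (wt j) l\<bar>"]) auto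
    next
      case False
      thus ?thesis using lat[of j] B by (simp add: rat_char_def char_lattice_def)
    qed
    have "\<bar>e' * rat_char (wt j) l\<bar> < e" for l
    proof -
      have "\<bar>rat_char (wt j) l\<bar> < 1 + B" using bound[of l] by linarith
      hence "e' * \<bar>rat_char (wt j) l\<bar> < e' * (1 + B)"
        using e B by (intro mult_strict_left_mono) (auto simp: e'_def)
      thus ?thesis using e B by (simp add: e'_def abs_mult)
    qed
    hence e': "e' > 0" "\<And>l. \<bar>e' * rat_char (wt j) l\<bar> < e" using e B by (simp_all add: e'_def)
    define z where "z = rat_char (wt i) - qscale e' (rat_char (wt j))"
    have "rat_char (wt i) \<in> F" "rat_char (wt j) \<in> F" using i j by (auto simp: cone_interior_def)
    hence "z \<in> qvec.span F" unfolding z_def by (intro qvec.span_diff qvec.span_scale qvec.span_base)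
    hence "z \<in> F" by (rule near) (use e' in \<open>simp add: z_def qscale_def\<close>)
    hence "z \<in> weight_cone wt" using sub by blast
    then obtain q where q: "\<And>l. 0 \<le> q l" "\<And>t. z t = (\<Sum>l\<in>UNIV. q l * rat_char (wt l) t)"
      by (auto simp: weight_cone_iff)
    define c where "c l = q l + (if l = j then e' else 0) - (if l = i then 1 else 0)" for l
    have "(\<Sum>l\<in>UNIV. c l * rat_char (wt l) t) = z t + e' * rat_char (wt j) t - rat_char (wt i) t" for t
      by (simp add: c_def q(2) distrib_right left_diff_distrib sum.distrib sum_subtractf
          if_distrib[of "\<lambda>x. x * _"] cong: if_cong)
    hence rel: "(\<Sum>l\<in>UNIV. c l * rat_char (wt l) t) = 0" for t by (simp add: z_def qscale_def)
    have "0 < c j" using e'(1) q(1)[of j] ne by (simp add: c_def)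
    then obtain k where k: "c k < 0" "y $ k = 0"
      using coordinate_zero_from_relation[OF rel y(1) _ y(2)] by blast
    have "k = i"
    proof (rule ccontr)
      assume "k \<noteq> i"
      hence "0 \<le> c k" using q(1)[of k] e'(1) by (simp add: c_def)
      thus False using k by simp
    qed
    thus ?thesis using k by simp
  qed
  have "i = j" if ij: "rat_char (wt i) \<in> cone_interior F" "rat_char (wt j) \<in> cone_interior F" for i j
  proof (rule ccontr)
    assume ne: "i \<noteq> j"
    have "\<not> weak_separation (orbit_closure r wt :: ('k ^ 'n) set)"
      by (rule not_weak_separation_if_coordinates_agree[OF ne])
        (use vanish[OF ij _ _ ne] vanish[OF ij(2,1) _ _ ne[symmetric]] in blast)
    thus False using ws by simp
  qed
  thus ?thesis by (simp add: card_le_Suc0_iff_eq)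
qed

section \<open>Sufficiency of the conditions\<close>

lemma weak_separation_if_few_interior:
  fixes wt :: "'n::finite \<Rightarrow> nat \<Rightarrow> int"
  assumes lat: "\<And>i. wt i \<in> char_lattice r"
    and few: "\<And>F. cone_face r F (weight_cone wt) \<Longrightarrow> card {i. rat_char (wt i) \<in> cone_interior F} \<le> 1"
  shows "weak_separation (orbit_closure r wt :: ('k::alg_closed_field ^ 'n) set)"
  unfolding weak_separation_def
proof (intro allI impI notI; elim conjE)
  fix H H' :: "('k ^ 'n) set"
  assume H: "hyperplane H" "hyperplane H'" "H \<noteq> H'"
    and eq: "H \<inter> orbit_closure r wt = H' \<inter> orbit_closure r wt"
  obtain a where a: "\<exists>i. a i \<noteq> 0" "H = {x. (\<Sum>i\<in>UNIV. a i * x $ i) = 0}"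
    using hyperplane_eq_kernel[OF H(1)] by blast
  obtain b where b: "\<exists>i. b i \<noteq> 0" "H' = {x. (\<Sum>i\<in>UNIV. b i * x $ i) = 0}"
    using hyperplane_eq_kernel[OF H(2)] by blast
  have zeros: "same_zeros r wt a b {i. pairing r u (wt i) = 0}" if u: "\<forall>i. 0 \<le> pairing r u (wt i)" for u
    unfolding same_zeros_def
  proof
    fix s :: "nat \<Rightarrow> 'k" assume s: "s \<in> torus r"
    define x :: "'k ^ 'n" where "x = (\<chi> i. if pairing r u (wt i) = 0 then char_eval r (wt i) s else 0)"
    have x: "x \<in> orbit_closure r wt"
      unfolding x_def by (rule face_point_in_orbit_closure[OF _ s]) (use u in blast)
    have sum: "(\<Sum>i\<in>UNIV. c i * x $ i) = char_sum r wt c {i. pairing r u (wt i) = 0} s" for c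
      unfolding char_sum_def by (rule sum.mono_neutral_cong_right) (auto simp: x_def)
    have "x \<in> H \<longleftrightarrow> x \<in> H'" using eq x by blast
    thus "char_sum r wt a {i. pairing r u (wt i) = 0} s = 0 \<longleftrightarrow>
        char_sum r wt b {i. pairing r u (wt i) = 0} s = 0"
      by (simp add: a(2) b(2) sum)
  qed
  have prop_ab: "a i * b j = a j * b i" for i j
    by (rule coefficients_proportional[OF lat few zeros])
  \<comment> \<open>Multiplying by a non-zero \<open>c i\<close> shows that one kernel lies in the
    other; exchanging \<open>a\<close> and \<open>b\<close> gives equality.\<close>
  have "(\<Sum>i\<in>UNIV. c' i * x $ i) = 0"
    if pr: "\<And>i j. c i * c' j = c j * c' i" and c: "\<exists>i. c i \<noteq> 0" and zero: "(\<Sum>i\<in>UNIV. c i * x $ i) = 0"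
    for c c' and x :: "'k ^ 'n"
  proof -
    obtain i where i: "c i \<noteq> 0" using c by blast
    have "c i * (\<Sum>j\<in>UNIV. c' j * x $ j) = (\<Sum>j\<in>UNIV. (c i * c' j) * x $ j)"
      by (simp add: sum_distrib_left mult_ac)
    also have "\<dots> = (\<Sum>j\<in>UNIV. (c j * c' i) * x $ j)" by (simp only: pr[of i])
    also have "\<dots> = c' i * (\<Sum>j\<in>UNIV. c j * x $ j)" by (simp add: sum_distrib_left mult_ac)
    finally show ?thesis using i zero by simp
  qed
  from this[of a b, OF prop_ab a(1)] this[of b a, OF _ b(1)] prop_ab
  have "H = H'" unfolding a(2) b(2) by (auto simp: mult.commute)
  thus False using H(3) by simp
qed

theorem theorem4:
  fixes r :: nat
    and wt :: "'n::finite \<Rightarrow> nat \<Rightarrow> int"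
    and X :: "('k::alg_closed_field ^ 'n) set"
    and K :: "(nat \<Rightarrow> rat) set"
  assumes "\<And>i. wt i \<in> char_lattice r"
    and "X = orbit_closure r wt"
    and "K = weight_cone wt"
  shows "(weak_separation X \<longleftrightarrow>
           strictly_convex K \<and>
           (\<forall>F. cone_face r F K \<longrightarrow> card {i. rat_char (wt i) \<in> cone_interior F} \<le> 1)) \<and>
         ((\<forall>F. cone_face r F K \<longrightarrow> card {i. rat_char (wt i) \<in> cone_interior F} \<le> 1) \<longrightarrow>
           (\<forall>i j. i \<noteq> j \<longrightarrow>
             {qscale q (rat_char (wt i)) | q. 0 \<le> q} \<noteq> {qscale q (rat_char (wt j)) | q. 0 \<le> q}))"
  unfolding assms(2,3)
proof (intro conjI iffI impI allI)
  assume ws: "weak_separation (orbit_closure r wt :: ('k ^ 'n) set)"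
  show "strictly_convex (weight_cone wt)"
    by (rule strictly_convex_if_weak_separation[OF assms(1) ws])
  show "card {i. rat_char (wt i) \<in> cone_interior F} \<le> 1" if "cone_face r F (weight_cone wt)" for F
    by (rule few_interior_if_weak_separation[OF assms(1) ws that])
next
  assume "strictly_convex (weight_cone wt) \<and>
    (\<forall>F. cone_face r F (weight_cone wt) \<longrightarrow> card {i. rat_char (wt i) \<in> cone_interior F} \<le> 1)"
  thus "weak_separation (orbit_closure r wt :: ('k ^ 'n) set)"
    by (intro weak_separation_if_few_interior[OF assms(1)]) blast
next
  fix i j :: 'n
  assume "\<forall>F. cone_face r F (weight_cone wt) \<longrightarrow> card {i. rat_char (wt i) \<in> cone_interior F} \<le> 1" "i \<noteq> j"
  thus "{qscale q (rat_char (wt i)) | q. 0 \<le> q} \<noteq> {qscale q (rat_char (wt j)) | q. 0 \<le> q}"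
    by (intro rays_distinct_if_few_interior[OF assms(1)]) blast+
qed

end
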